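(* Let $(X,d)$ be a geometrically doubling quasi-metric space with quasi-triangle constant $A_0$, and let $s^k_\alpha(x):=\mathbb{P}_\omega\big(x\in\bar Q^k_\alpha(\omega)\big)$ ($k\in\mathbb{Z}$, $x^k_\alpha\in\mathscr{X}^k$, $x\in X$) be the spline functions built from the random dyadic cubes described in the context. Then, for all $k$ and all $\alpha$, the following hold. (1) Bounded support: for all $x\in X$, $$1_{B(x^k_\alpha,\frac18A_0^{-3}\delta^k)}(x)\le s^k_\alpha(x)\le 1_{B(x^k_\alpha,8A_0^5\delta^k)}(x).$$ (2) Interpolation and reproducing properties: for all $x\in X$ and all $\beta$ with $x^k_\beta\in\mathscr{X}^k$, $$s^k_\alpha(x^k_\beta)=\delta_{\alpha\beta},\qquad \sum_{\alpha}s^k_\alpha(x)=1,\qquad s^k_\alpha(x)=\sum_\beta p^k_{\alpha\beta}\, s^{k+1}_\beta(x),$$ where in the last sum $\beta$ runs over the indices of $\mathscr{X}^{k+1}$, the coefficients $p^k_{\alpha\beta}$ are nonnegative and independent of $x$, for each $(k,\alpha)$ only finitely many $p^k_{\alpha\beta}$ are nonzero, and $\sum_\alpha p^k_{\alpha\beta}=1$ for every $\beta$. (3) H\"older-continuity: there is a constant $C$, independent of $k,\alpha,x,y$, such that for all $x,y\in X$, $$|s^k_\alpha(x)-s^k_\alpha(y)|\le C\Big(\frac{d(x,y)}{\delta^k}\Big)^{\eta}.$$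
   Context: Quasi-metric space: $d:X\times X\to[0,\infty)$ is symmetric, $d(x,y)=0$ iff $x=y$, and $d(x,y)\le A_0(d(x,z)+d(z,y))$ with $A_0\ge1$. $B(x,r):=\{y\in X:d(x,y)<r\}$. Geometrically doubling: there is $N\in\mathbb{N}$ such that every ball of radius $r$ contains at most $N$ points whose mutual quasi-distances exceed $r/2$. A set is open if it contains, with each of its points, a ball centred at that point. For sets, $d(x,E)=\inf_{y\in E}d(x,y)$. Random dyadic system. Fix $\delta\in(0,1)$ with $\delta\le\frac1{1000}A_0^{-10}$. Reference points: $\mathscr{X}^0=\{x^0_\alpha\}_\alpha$ is a maximal $1$-separated set in $X$ ($r$-separated: distinct points at distance $\ge r$); inductively for $k\ge1$, $\mathscr{X}^k=\{x^k_\alpha\}_\alpha\supseteq\mathscr{X}^{k-1}$ is a maximal $\delta^k$-separated set in $X$ and $\mathscr{X}^{-k}=\{x^{-k}_\alpha\}_\alpha\subseteq\mathscr{X}^{-(k-1)}$ is a maximal $\delta^{-k}$-separated subset of $\mathscr{X}^{-(k-1)}$. Reference partial order $\le$ on pairs $(k,\alpha)$, generated by a parent relation: each $(k+1,\beta)$ satisfies $(k+1,\beta)\le(k,\alpha)$ for exactly one $\alpha$, chosen so that $d(x^{k+1}_\beta,x^k_\alpha)<\frac1{2A_0}\delta^k\Rightarrow(k+1,\beta)\le(k,\alpha)\Rightarrow d(x^{k+1}_\beta,x^k_\alpha)<2A_0\delta^k$; then $(k+1,\beta)$ is a child of $(k,\alpha)$. Distinct pairs $(k,\alpha),(k,\beta)$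 are neighbours if they have children $(k+1,\gamma)\le(k,\alpha)$, $(k+1,\theta)\le(k,\beta)$ with $d(x^{k+1}_\gamma,x^{k+1}_\theta)<(2A_0)^{-1}\delta^k$. Let $L$ and $M$ be the (finite) maximal numbers of neighbours and of children. Fix labels $\mathrm{label}_1(k,\alpha)\in\{0,\dots,L\}$, different for neighbours, and $\mathrm{label}_2(k,\alpha)\in\{1,\dots,M\}$, different for different children of the same parent. Let $\Omega=(\{0,\dots,L\}\times\{1,\dots,M\})^{\mathbb{Z}}$, $\omega=(\omega_k)_{k}$, $\omega_k=(\ell_k,m_k)$, with the product probability $\mathbb{P}_\omega$ of uniform measures. New points: $z^k_\alpha=z^k_\alpha(\omega):=x^{k+1}_\beta$ if $\mathrm{label}_1(k,\alpha)=\ell_k$ and there is a child $(k+1,\beta)\le(k,\alpha)$ with $\mathrm{label}_2(k+1,\beta)=m_k$; otherwise $z^k_\alpha:=x^k_\alpha$. New partial order $\le_\omega$, generated by: $(k+1,\beta)\le_\omega(k,\alpha)$ iff either $d(x^{k+1}_\beta,z^k_\alpha)<\frac14A_0^{-2}\delta^k$, or $(k+1,\beta)\le(k,\alpha)$ and there is no $\gamma$ with $d(x^{k+1}_\beta,z^k_\gamma)<\frac14A_0^{-2}\delta^k$. Cubes: $\hat Q^k_\alpha(\omega)=\{z^\ell_\beta(\omega):(\ell,\beta)\le_\omega(k,\alpha)\}$, $\bar Q^k_\alpha(\omega)$ is its closure, $\tilde Q^k_\alpha(\omega)$ is the interior of $\bar Q^k_\alpha(\omega)$. Exponent $\eta$: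 with $\partial_\varepsilon Q^k_\alpha(\omega)=\{y\in\bar Q^k_\alpha(\omega):d(y,X\setminus\tilde Q^k_\alpha(\omega))<\varepsilon\delta^k\}$, $\eta\in(0,1]$ is a fixed exponent such that for some constant $C$, $\mathbb{P}_\omega(x\in\bigcup_\alpha\partial_\varepsilon Q^k_\alpha(\omega))\le C\varepsilon^\eta$ for all $x\in X$, $k\in\mathbb{Z}$, $\varepsilon>0$ (such an exponent exists). *)

theory Defs
  imports "HOL-Analysis.Analysis" "HOL-Probability.Probability"
begin

section \<open>Geometrically doubling quasi-metric spaces\<close>

locale quasi_metric_space =
  fixes d :: "'a \<Rightarrow> 'a \<Rightarrow> real" and A0 :: real
  assumes d_nonneg: "0 \<le> d x y"
    and d_sym: "d x y = d y x"
    and d_zero_iff: "d x y = 0 \<longleftrightarrow> x = y"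
    and A0_ge_1: "1 \<le> A0"
    and quasi_triangle: "d x y \<le> A0 * (d x z + d z y)"
begin

definition qball :: "'a \<Rightarrow> real \<Rightarrow> 'a set" where
  "qball x r = {y. d x y < r}"

text \<open>Quasi-metric balls need not be open sets of this topology.\<close>

definition qtop :: "'a topology" where
  "qtop = topology (\<lambda>U. \<forall>x\<in>U. \<exists>r>0. qball x r \<subseteq> U)"

lemma istopology_qball: "istopology (\<lambda>U. \<forall>x\<in>U. \<exists>r>0. qball x r \<subseteq> U)"
  unfolding istopology_def
proof (intro conjI allI impI ballI)
  fix S T x
  assume S: "\<forall>x\<in>S. \<exists>r>0. qball x r \<subseteq> S" and T: "\<forall>x\<in>T. \<exists>r>0. qball x r \<subseteq> T"
    and x: "x \<in> S \<inter> T"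
  obtain r where r: "r > 0" "qball x r \<subseteq> S" using S x by blast
  obtain s where s: "s > 0" "qball x s \<subseteq> T" using T x by blast
  have "qball x (min r s) \<subseteq> S \<inter> T" using r(2) s(2) by (auto simp: qball_def)
  then show "\<exists>r>0. qball x r \<subseteq> S \<inter> T" using r(1) s(1) by (intro exI[of _ "min r s"]) simp
next
  fix \<K> x
  assume "\<forall>K\<in>\<K>. \<forall>x\<in>K. \<exists>r>0. qball x r \<subseteq> K" and "x \<in> \<Union>\<K>"
  then show "\<exists>r>0. qball x r \<subseteq> \<Union>\<K>" by (meson Sup_upper UnionE order_trans)
qed

lemma openin_qtop: "openin qtop U \<longleftrightarrow> (\<forall>x\<in>U. \<exists>r>0. qball x r \<subseteq> U)"
  unfolding qtop_def by (simp add: topology_inverse'[OF istopology_qball])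

lemma topspace_qtop: "topspace qtop = UNIV"
proof -
  have "openin qtop UNIV" unfolding openin_qtop by (auto intro: exI[of _ "1::real"])
  then show ?thesis by (metis openin_subset top.extremum_uniqueI)
qed

text \<open>The infimum is taken in the extended reals, so that the distance to the empty set
  is \<open>\<infinity>\<close>.\<close>

definition dist_to_set :: "'a \<Rightarrow> 'a set \<Rightarrow> ennreal" where
  "dist_to_set x E = (INF y\<in>E. ennreal (d x y))"

definition separated :: "real \<Rightarrow> 'a set \<Rightarrow> bool" where
  "separated r E \<longleftrightarrow> (\<forall>x\<in>E. \<forall>y\<in>E. x \<noteq> y \<longrightarrow> r \<le> d x y)"

definition maximal_separated :: "real \<Rightarrow> 'a set \<Rightarrow> 'a set \<Rightarrow> bool" where
  "maximal_separated r S E \<longleftrightarrow> E \<subseteq> S \<and> separated r E \<and>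
     (\<forall>F. E \<subseteq> F \<and> F \<subseteq> S \<and> separated r F \<longrightarrow> F = E)"

end

locale doubling_quasi_metric_space = quasi_metric_space +
  assumes geometrically_doubling:
    "\<exists>N::nat. \<forall>x r F. F \<subseteq> qball x r \<and> (\<forall>u\<in>F. \<forall>v\<in>F. u \<noteq> v \<longrightarrow> r / 2 < d u v)
       \<longrightarrow> finite F \<and> card F \<le> N"

section \<open>Reference dyadic points\<close>

text \<open>
  \<open>idx k\<close> is the set of indices \<open>\<alpha>\<close> at level \<open>k\<close> and \<open>pt k \<alpha>\<close> is the reference point
  \<open>x\<^sup>k\<^sub>\<alpha>\<close>. The reference order is given by its parent map: \<open>par k \<beta>\<close> is the unique \<open>\<alpha>\<close>
  with \<open>(k+1,\<beta>) \<le> (k,\<alpha>)\<close>. Only comparisons between consecutive levels of this order are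
  ever used, and these are exactly the parent relations.
\<close>

locale reference_dyadic_system = doubling_quasi_metric_space d A0
  for d :: "'a \<Rightarrow> 'a \<Rightarrow> real" and A0 :: real +
  fixes \<delta> :: real
    and idx :: "int \<Rightarrow> 'i set"
    and pt :: "int \<Rightarrow> 'i \<Rightarrow> 'a"
    and par :: "int \<Rightarrow> 'i \<Rightarrow> 'i"
  assumes \<delta>_pos: "0 < \<delta>" and \<delta>_less_1: "\<delta> < 1"
    and \<delta>_small: "\<delta> \<le> 1 / 1000 * A0 powi (-10)"
    and pt_inj: "inj_on (pt k) (idx k)"
    and points_0: "maximal_separated 1 UNIV (pt 0 ` idx 0)"
    and points_pos: "1 \<le> k \<Longrightarrow> pt (k - 1) ` idx (k - 1) \<subseteq> pt k ` idx k \<and>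
          maximal_separated (\<delta> powi k) UNIV (pt k ` idx k)"
    and points_neg: "1 \<le> k \<Longrightarrow>
          maximal_separated (\<delta> powi (- k)) (pt (- (k - 1)) ` idx (- (k - 1))) (pt (- k) ` idx (- k))"
    and par_idx: "\<beta> \<in> idx (k + 1) \<Longrightarrow> par k \<beta> \<in> idx k"
    and par_close: "\<beta> \<in> idx (k + 1) \<Longrightarrow> \<alpha> \<in> idx k \<Longrightarrow>
          d (pt (k + 1) \<beta>) (pt k \<alpha>) < 1 / (2 * A0) * \<delta> powi k \<Longrightarrow> par k \<beta> = \<alpha>"
    and par_dist: "\<beta> \<in> idx (k + 1) \<Longrightarrow>
          d (pt (k + 1) \<beta>) (pt k (par k \<beta>)) < 2 * A0 * \<delta> powi k"
begin

definition children :: "int \<Rightarrow> 'i \<Rightarrow> 'i set" where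
  "children k \<alpha> = {\<beta> \<in> idx (k + 1). par k \<beta> = \<alpha>}"

definition neighbours :: "int \<Rightarrow> 'i \<Rightarrow> 'i set" where
  "neighbours k \<alpha> = {\<beta> \<in> idx k. \<beta> \<noteq> \<alpha> \<and>
     (\<exists>\<gamma>\<in>children k \<alpha>. \<exists>\<theta>\<in>children k \<beta>.
        d (pt (k + 1) \<gamma>) (pt (k + 1) \<theta>) < inverse (2 * A0) * \<delta> powi k)}"

definition max_neighbours :: nat where
  "max_neighbours = Max {card (neighbours k \<alpha>) | k \<alpha>. \<alpha> \<in> idx k}"

definition max_children :: nat where
  "max_children = Max {card (children k \<alpha>) | k \<alpha>. \<alpha> \<in> idx k}"

end

section \<open>Random dyadic cubes and splines\<close>

locale random_dyadic_system = reference_dyadic_system d A0 \<delta> idx pt par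
  for d :: "'a \<Rightarrow> 'a \<Rightarrow> real" and A0 :: real and \<delta> :: real
    and idx :: "int \<Rightarrow> 'i set" and pt :: "int \<Rightarrow> 'i \<Rightarrow> 'a" and par :: "int \<Rightarrow> 'i \<Rightarrow> 'i" +
  fixes label1 label2 :: "int \<Rightarrow> 'i \<Rightarrow> nat"
  assumes label1_range: "\<alpha> \<in> idx k \<Longrightarrow> label1 k \<alpha> \<in> {0..max_neighbours}"
    and label1_neighbours: "\<alpha> \<in> idx k \<Longrightarrow> \<beta> \<in> neighbours k \<alpha> \<Longrightarrow> label1 k \<alpha> \<noteq> label1 k \<beta>"
    and label2_range: "\<alpha> \<in> idx k \<Longrightarrow> label2 k \<alpha> \<in> {1..max_children}"
    and label2_children: "\<alpha> \<in> idx k \<Longrightarrow> \<beta> \<in> children k \<alpha> \<Longrightarrow> \<gamma> \<in> children k \<alpha> \<Longrightarrow> \<beta> \<noteq> \<gamma> \<Longrightarrow>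
          label2 (k + 1) \<beta> \<noteq> label2 (k + 1) \<gamma>"
begin

definition prob_\<omega> :: "(int \<Rightarrow> nat \<times> nat) measure" where
  "prob_\<omega> = (\<Pi>\<^sub>M k\<in>UNIV. uniform_count_measure ({0..max_neighbours} \<times> {1..max_children}))"

text \<open>The child in the definition of the new point is unique, since distinct children of
  the same parent carry different second labels.\<close>

definition new_pt :: "(int \<Rightarrow> nat \<times> nat) \<Rightarrow> int \<Rightarrow> 'i \<Rightarrow> 'a" where
  "new_pt \<omega> k \<alpha> =
    (if label1 k \<alpha> = fst (\<omega> k) \<and> (\<exists>\<beta>\<in>children k \<alpha>. label2 (k + 1) \<beta> = snd (\<omega> k))
     then pt (k + 1) (THE \<beta>. \<beta> \<in> children k \<alpha> \<and> label2 (k + 1) \<beta> = snd (\<omega> k))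
     else pt k \<alpha>)"

text \<open>A pair \<open>(p, q)\<close> in the following relations stands for \<open>p \<le>\<^sub>\<omega> q\<close>.\<close>

definition new_step :: "(int \<Rightarrow> nat \<times> nat) \<Rightarrow> ((int \<times> 'i) \<times> (int \<times> 'i)) set" where
  "new_step \<omega> = {((k + 1, \<beta>), (k, \<alpha>)) | k \<alpha> \<beta>. \<alpha> \<in> idx k \<and> \<beta> \<in> idx (k + 1) \<and>
     (d (pt (k + 1) \<beta>) (new_pt \<omega> k \<alpha>) < 1 / 4 * A0 powi (-2) * \<delta> powi k \<or>
      \<beta> \<in> children k \<alpha> \<and>
      \<not> (\<exists>\<gamma>\<in>idx k. d (pt (k + 1) \<beta>) (new_pt \<omega> k \<gamma>) < 1 / 4 * A0 powi (-2) * \<delta> powi k))}"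

definition new_order :: "(int \<Rightarrow> nat \<times> nat) \<Rightarrow> ((int \<times> 'i) \<times> (int \<times> 'i)) set" where
  "new_order \<omega> = (new_step \<omega>)\<^sup>*"

definition pre_cube :: "(int \<Rightarrow> nat \<times> nat) \<Rightarrow> int \<Rightarrow> 'i \<Rightarrow> 'a set" where
  "pre_cube \<omega> k \<alpha> = {new_pt \<omega> l \<beta> | l \<beta>. \<beta> \<in> idx l \<and> ((l, \<beta>), (k, \<alpha>)) \<in> new_order \<omega>}"

definition closed_cube :: "(int \<Rightarrow> nat \<times> nat) \<Rightarrow> int \<Rightarrow> 'i \<Rightarrow> 'a set" where
  "closed_cube \<omega> k \<alpha> = qtop closure_of (pre_cube \<omega> k \<alpha>)"

definition open_cube :: "(int \<Rightarrow> nat \<times> nat) \<Rightarrow> int \<Rightarrow> 'i \<Rightarrow> 'a set" where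
  "open_cube \<omega> k \<alpha> = qtop interior_of (closed_cube \<omega> k \<alpha>)"

definition boundary_layer :: "real \<Rightarrow> (int \<Rightarrow> nat \<times> nat) \<Rightarrow> int \<Rightarrow> 'i \<Rightarrow> 'a set" where
  "boundary_layer \<epsilon> \<omega> k \<alpha> =
     {y \<in> closed_cube \<omega> k \<alpha>. dist_to_set y (UNIV - open_cube \<omega> k \<alpha>) < ennreal (\<epsilon> * \<delta> powi k)}"

text \<open>
  The event below need not be measurable in general, because balls need not be open and
  \<open>X\<close> need not be complete. Its probability is therefore taken as an outer measure, which
  agrees with the measure on measurable events; \<open>measure\<close> would return the value 0 on
  non-measurable ones.
\<close>

definition boundary_exponent :: "real \<Rightarrow> bool" where
  "boundary_exponent \<eta> \<longleftrightarrow> 0 < \<eta> \<and> \<eta> \<le> 1 \<and>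
     (\<exists>C::real. \<forall>x k. \<forall>\<epsilon>>0.
        outer_measure_of prob_\<omega> {\<omega> \<in> space prob_\<omega>. x \<in> (\<Union>\<alpha>\<in>idx k. boundary_layer \<epsilon> \<omega> k \<alpha>)}
          \<le> ennreal (C * \<epsilon> powr \<eta>))"

definition spline :: "int \<Rightarrow> 'i \<Rightarrow> 'a \<Rightarrow> real" where
  "spline k \<alpha> x = measure prob_\<omega> {\<omega> \<in> space prob_\<omega>. x \<in> closed_cube \<omega> k \<alpha>}"

end

end

(*
  The new points at level k are (2 A0)^-1 delta^k-separated, so every index has exactly one new
  parent, and this parent depends on the single coordinate omega_k. All deep reference points in a
  small ball around a new point descend from it; hence a pre-cube never meets the closure of
  another pre-cube of the same level, and a point lying in two closed cubes lies in the
  epsilon-boundary layer for every epsilon. The boundary exponent makes this a null event, which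
  gives the partition of unity.

  A closed cube is the finite union of the closed cubes of its new children. Membership in a cube
  of level k + 1 depends only on the coordinates omega_l with l > k, so it is independent of the
  new parents at level k; this yields the refinement equation with p^k_{alpha beta} the
  probability that alpha is the new parent of beta. If x lies in a closed cube and y does not,
  then x is in the boundary layer of width of order d(x, y), whence the Hoelder bound.
*)

theory Submission
  imports Defs
begin

section \<open>Quasi-metric topology and separated sets\<close>

context quasi_metric_space
begin

lemma A0_pos: "0 < A0"
  using A0_ge_1 by linarith

lemma d_self [simp]: "d x x = 0"
  by (simp add: d_zero_iff)

lemma quasi_triangle_le:
  assumes "d x z \<le> a" "d z y \<le> b"
  shows "d x y \<le> A0 * (a + b)"
proof -
  have "d x y \<le> A0 * (d x z + d z y)" by (rule quasi_triangle)
  also have "\<dots> \<le> A0 * (a + b)" using assms A0_pos by (intro mult_left_mono) auto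
  finally show ?thesis .
qed

lemma quasi_triangle_less:
  assumes "d x z < a" "d z y \<le> b"
  shows "d x y < A0 * (a + b)"
proof -
  have "d x y \<le> A0 * (d x z + d z y)" by (rule quasi_triangle)
  also have "\<dots> < A0 * (a + b)" using assms A0_pos by (intro mult_strict_left_mono) auto
  finally show ?thesis .
qed

text \<open>Balls need not be open, so the complement of the right-hand side is shown open by hand:
  if x keeps distance at least r from \<open>E\<close>, every point of the ball of radius
  \<open>r / (2 * A0)\<close> around x keeps distance at least \<open>r / (2 * A0)\<close> from
  \<open>E\<close>.\<close>

lemma closure_of_qtop: "qtop closure_of E = {x. \<forall>r>0. \<exists>y\<in>E. d x y < r}" (is "_ = ?C")
proof (rule closure_of_unique)
  show "E \<subseteq> ?C" by force
  have "openin qtop (UNIV - ?C)"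
    unfolding openin_qtop
  proof
    fix x assume "x \<in> UNIV - ?C"
    then obtain r where r: "r > 0" "\<And>y. y \<in> E \<Longrightarrow> r \<le> d x y" by force
    have "qball x (r / (2 * A0)) \<subseteq> UNIV - ?C"
    proof
      fix y assume y: "y \<in> qball x (r / (2 * A0))"
      have "r / (2 * A0) \<le> d y z" if "z \<in> E" for z
      proof (rule ccontr)
        assume "\<not> r / (2 * A0) \<le> d y z"
        with y have "d x z < A0 * (r / (2 * A0) + r / (2 * A0))"
          by (intro quasi_triangle_less) (auto simp: qball_def)
        with r(2)[OF that] show False using A0_pos by (simp add: field_simps)
      qed
      moreover have "r / (2 * A0) > 0" using r A0_pos by simp
      ultimately show "y \<in> UNIV - ?C" by (auto simp: not_less)
    qed
    moreover have "r / (2 * A0) > 0" using r A0_pos by simp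
    ultimately show "\<exists>r>0. qball x r \<subseteq> UNIV - ?C" by blast
  qed
  then show "closedin qtop ?C" by (simp add: closedin_def topspace_qtop)
next
  fix T assume T: "E \<subseteq> T" "closedin qtop T"
  then have "openin qtop (UNIV - T)" by (simp add: closedin_def topspace_qtop)
  have "x \<in> T" if x: "x \<in> ?C" for x
  proof (rule ccontr)
    assume "x \<notin> T"
    then obtain r where "r > 0" "qball x r \<subseteq> UNIV - T"
      using \<open>openin qtop (UNIV - T)\<close> unfolding openin_qtop by blast
    moreover obtain y where "y \<in> E" "d x y < r" using x \<open>r > 0\<close> by blast
    ultimately show False using T(1) by (auto simp: qball_def)
  qed
  then show "?C \<subseteq> T" by blast
qed

lemma maximal_separated_near:
  assumes "maximal_separated r S E" "x \<in> S" "0 < r"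
  shows "\<exists>y\<in>E. d x y < r"
proof (rule ccontr)
  assume far: "\<not> (\<exists>y\<in>E. d x y < r)"
  then have "separated r (insert x E)"
    using assms(1) unfolding maximal_separated_def separated_def
    by (metis d_sym insert_iff linorder_not_le)
  then have "insert x E = E"
    using assms(1,2) unfolding maximal_separated_def by blast
  with far assms(3) show False by (metis d_self insertI1)
qed

end

section \<open>Finiteness of separated sets in balls\<close>

context doubling_quasi_metric_space
begin

text \<open>Radii grow by 4/3 from \<open>t / (2 * A0)\<close>, where a ball holds at most one point
  of \<open>F\<close>. Doubling covers the part of \<open>F\<close> in a ball of radius r by
  finitely many balls of radius 3r/4. The factor is not 1/2 because doubling speaks of distances
  strictly above r/2, while a point outside a ball of radius r/2 is only known to be at distance at
  least r/2 from its centre.\<close>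

lemma finite_separated_aux:
  assumes "0 < t" "separated t F" "F \<subseteq> qball x ((4 / 3) ^ n * (t / (2 * A0)))"
  shows "finite F"
  using assms(2,3)
proof (induction n arbitrary: x F)
  case 0
  have "u = v" if "u \<in> F" "v \<in> F" for u v
  proof (rule ccontr)
    assume "u \<noteq> v"
    then have "t \<le> d u v" using 0(1) that by (auto simp: separated_def)
    moreover have "d u v < A0 * (t / (2 * A0) + t / (2 * A0))"
      using 0(2) that by (intro quasi_triangle_less[of _ x]) (auto simp: qball_def d_sym subset_iff intro: less_imp_le)
    ultimately show False using A0_pos by (simp add: field_simps)
  qed
  then show ?case by (metis finite.emptyI finite_insert finite_subset insertCI subsetI)
next
  case (Suc n)
  define r where "r = (4 / 3) ^ Suc n * (t / (2 * A0))"
  have r: "0 < r" "3 / 4 * r = (4 / 3) ^ n * (t / (2 * A0))"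
    using \<open>0 < t\<close> A0_pos by (auto simp: r_def)
  define P where "P G \<longleftrightarrow> G \<subseteq> F \<and> (\<forall>u\<in>G. \<forall>v\<in>G. u \<noteq> v \<longrightarrow> r / 2 < d u v)" for G
  obtain N where N: "\<And>G. P G \<Longrightarrow> finite G \<and> card G \<le> N"
    using geometrically_doubling Suc.prems(2) unfolding P_def r_def by (meson subset_trans)
  have "P {}" by (simp add: P_def)
  moreover have "\<forall>G. P G \<longrightarrow> card G < Suc N" using N by (simp add: le_imp_less_Suc)
  \<comment> \<open>Cardinalities are bounded by \<open>N\<close>, so one of them is greatest; a
    point far from all of \<open>G\<close> could be added to it.\<close>
  ultimately obtain G where G: "P G" "\<And>H. P H \<Longrightarrow> card H \<le> card G"
    using ex_has_greatest_nat[of P "{}" card "Suc N"] by (metis le_eq_less_or_eq)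
  have "F \<subseteq> (\<Union>g\<in>G. F \<inter> qball g (3 / 4 * r))"
  proof
    fix u assume u: "u \<in> F"
    show "u \<in> (\<Union>g\<in>G. F \<inter> qball g (3 / 4 * r))"
    proof (rule ccontr)
      assume "u \<notin> (\<Union>g\<in>G. F \<inter> qball g (3 / 4 * r))"
      with u have far: "\<And>g. g \<in> G \<Longrightarrow> 3 / 4 * r \<le> d g u" by (force simp: qball_def)
      then have "r / 2 < d g u" if "g \<in> G" for g using r(1) that by fastforce
      then have "P (insert u G)" using G(1) u unfolding P_def by (metis d_sym insert_iff insert_subset)
      moreover have "u \<notin> G" using far[of u] r(1) by force
      ultimately show False using G(2)[of "insert u G"] N[OF G(1)] by simp
    qed
  qed
  moreover have "finite (F \<inter> qball g (3 / 4 * r))" for g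
    using Suc.prems(1) r(2) by (intro Suc.IH[of _ g]) (auto simp: separated_def mult.commute)
  ultimately show ?case using N[OF G(1)] by (metis finite_UN_I finite_subset)
qed

lemma finite_separated:
  assumes "0 < t" "separated t F" "F \<subseteq> qball x r"
  shows "finite F"
proof -
  obtain n where "r / (t / (2 * A0)) < (4 / 3) ^ n"
    using real_arch_pow[of "4 / 3" "r / (t / (2 * A0))"] by auto
  then have "r \<le> (4 / 3) ^ n * (t / (2 * A0))"
    using assms(1) A0_pos by (simp add: field_simps)
  then show ?thesis using assms by (intro finite_separated_aux[of t F x n]) (auto simp: qball_def)
qed

end

section \<open>Reference points across the levels\<close>

context reference_dyadic_system
begin

lemma scale_pos [simp]: "0 < \<delta> powi k"
  using \<delta>_pos by simp

lemma scale_Suc: "\<delta> powi (k + 1) = \<delta> * \<delta> powi k"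
  using \<delta>_pos by (simp add: power_int_add mult.commute)

lemma scale_mono: "k \<le> l \<Longrightarrow> \<delta> powi l \<le> \<delta> powi k"
  using \<delta>_pos \<delta>_less_1 by (simp add: power_int_decreasing)

lemma scale_tendsto: "(\<lambda>n. \<delta> powi int n) \<longlonglongrightarrow> 0"
  using \<delta>_pos \<delta>_less_1 by (simp add: LIMSEQ_realpow_zero)

text \<open>The form in which smallness of \<open>\<delta>\<close> is used: the factor gained by
  going one level down absorbs up to ten powers of \<open>A0\<close>.\<close>

lemma \<delta>_A0: "n \<le> 10 \<Longrightarrow> 1000 * \<delta> * A0 ^ n \<le> 1"
proof -
  assume "n \<le> 10"
  then have "1000 * \<delta> * A0 ^ n \<le> 1000 * \<delta> * A0 ^ 10"
    using \<delta>_pos A0_ge_1 by (intro mult_left_mono power_increasing) auto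
  also have "\<dots> \<le> 1"
  proof -
    have "A0 powi (-10) * A0 ^ 10 = 1" using A0_pos by (simp add: power_int_def field_simps)
    moreover have "1000 * \<delta> * A0 ^ 10 \<le> A0 powi (-10) * A0 ^ 10"
      using \<delta>_small A0_pos by (intro mult_right_mono) auto
    ultimately show ?thesis by simp
  qed
  finally show ?thesis .
qed

lemma pt_separated:
  assumes "\<alpha> \<in> idx k" "\<beta> \<in> idx k" "\<alpha> \<noteq> \<beta>"
  shows "\<delta> powi k \<le> d (pt k \<alpha>) (pt k \<beta>)"
proof -
  have "separated (\<delta> powi k) (pt k ` idx k)"
  proof -
    consider "k = 0" | "k \<ge> 1" | "- k \<ge> 1" by linarith
    then show ?thesis
      using points_0 points_pos[of k] points_neg[of "- k"]
      by cases (auto simp: maximal_separated_def)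
  qed
  moreover have "pt k \<alpha> \<noteq> pt k \<beta>" using assms pt_inj by (meson inj_onD)
  ultimately show ?thesis using assms by (auto simp: separated_def)
qed

lemma pt_next:
  assumes "\<alpha> \<in> idx k"
  shows "\<exists>\<beta>\<in>idx (k + 1). pt (k + 1) \<beta> = pt k \<alpha>"
proof -
  have "pt k ` idx k \<subseteq> pt (k + 1) ` idx (k + 1)"
  proof (cases "k \<ge> 0")
    case True
    then show ?thesis using points_pos[of "k + 1"] by simp
  next
    case False
    then have "1 \<le> - k" by simp
    from points_neg[OF this] show ?thesis by (simp add: maximal_separated_def add.commute)
  qed
  then show ?thesis using assms by (force simp: image_iff subset_iff)
qed

text \<open>At negative levels the points are maximal only inside the next finer reference set, so
  this radius is guaranteed for nonnegative levels alone; the cube arguments pass to deep levels to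
  use it.\<close>

lemma pt_dense:
  assumes "0 \<le> k"
  shows "\<exists>\<beta>\<in>idx k. d x (pt k \<beta>) < \<delta> powi k"
proof -
  have "maximal_separated (\<delta> powi k) UNIV (pt k ` idx k)"
    using points_0 points_pos[of k] assms by (cases "k = 0") auto
  from maximal_separated_near[OF this, of x] show ?thesis by auto
qed

lemma finite_idx_near: "finite {\<alpha> \<in> idx k. d x (pt k \<alpha>) < r}"
proof (rule finite_imageD[of "pt k"])
  show "inj_on (pt k) {\<alpha> \<in> idx k. d x (pt k \<alpha>) < r}"
    using pt_inj by (rule inj_on_subset) auto
  show "finite (pt k ` {\<alpha> \<in> idx k. d x (pt k \<alpha>) < r})"
    by (rule finite_separated[of "\<delta> powi k" _ x r])
       (auto simp: separated_def qball_def intro!: pt_separated)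
qed

text \<open>Balls of integer radius around an arbitrary point exhaust the indices. Measurability of
  the cube events relies on unions over indices being countable.\<close>

lemma countable_idx: "countable (idx k)"
proof -
  fix x
  have "idx k = (\<Union>n::nat. {\<alpha> \<in> idx k. d x (pt k \<alpha>) < real n})"
    using reals_Archimedean2 by auto
  also have "countable \<dots>" by (rule countable_UN[OF countableI_type countable_finite[OF finite_idx_near]])
  finally show ?thesis .
qed

lemma pt_par_far:
  assumes "\<gamma> \<in> idx (k + 1)" "\<alpha> \<in> idx k" "par k \<gamma> \<noteq> \<alpha>"
  shows "\<delta> powi k / (2 * A0) \<le> d (pt (k + 1) \<gamma>) (pt k \<alpha>)"
  using par_close[OF assms(1,2)] assms(3) by fastforce

end

section \<open>Geometry of the random cubes\<close>

context random_dyadic_system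
begin

text \<open>Even an unmoved point belongs to a child: by nestedness it reappears at level k + 1, and
  distance 0 forces the parent. The last conjunct, that only indices with the drawn label are moved,
  feeds the separation of new points.\<close>

lemma new_pt_child:
  assumes "\<alpha> \<in> idx k"
  shows "\<exists>\<gamma>\<in>children k \<alpha>. new_pt \<omega> k \<alpha> = pt (k + 1) \<gamma> \<and>
    (new_pt \<omega> k \<alpha> = pt k \<alpha> \<or> label1 k \<alpha> = fst (\<omega> k))"
proof (cases "label1 k \<alpha> = fst (\<omega> k) \<and> (\<exists>\<beta>\<in>children k \<alpha>. label2 (k + 1) \<beta> = snd (\<omega> k))")
  case True
  then obtain \<beta> where \<beta>: "\<beta> \<in> children k \<alpha>" "label2 (k + 1) \<beta> = snd (\<omega> k)" by blast
  have "(THE \<beta>. \<beta> \<in> children k \<alpha> \<and> label2 (k + 1) \<beta> = snd (\<omega> k)) = \<beta>"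
    using \<beta> label2_children[OF assms] by (intro the_equality) (auto, metis)
  then show ?thesis using True \<beta> by (auto simp: new_pt_def)
next
  case False
  obtain \<beta> where \<beta>: "\<beta> \<in> idx (k + 1)" "pt (k + 1) \<beta> = pt k \<alpha>"
    using pt_next[OF assms] by blast
  then have "par k \<beta> = \<alpha>" using assms A0_pos by (intro par_close) auto
  then show ?thesis using False \<beta> by (auto simp: new_pt_def children_def)
qed

lemma new_pt_dist:
  assumes "\<alpha> \<in> idx k"
  shows "d (new_pt \<omega> k \<alpha>) (pt k \<alpha>) < 2 * A0 * \<delta> powi k"
proof -
  obtain \<gamma> where "\<gamma> \<in> children k \<alpha>" "new_pt \<omega> k \<alpha> = pt (k + 1) \<gamma>"
    using new_pt_child[OF assms, of \<omega>] by blast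
  then show ?thesis using par_dist[of \<gamma> k] by (auto simp: children_def)
qed

lemma new_pt_pt_far:
  assumes "\<alpha> \<in> idx k" "\<beta> \<in> idx k" "\<alpha> \<noteq> \<beta>"
  shows "\<delta> powi k / (2 * A0) \<le> d (new_pt \<omega> k \<alpha>) (pt k \<beta>)"
  using new_pt_child[OF assms(1), of \<omega>] pt_par_far[of _ k \<beta>] assms
  by (auto simp: children_def)

text \<open>If one of the two points is unmoved, \<open>new_pt_pt_far\<close> applies. If both are
  moved, the two indices share the drawn label, hence are not neighbours, and this says that their
  children are far apart.\<close>

lemma new_pt_separated:
  assumes "\<alpha> \<in> idx k" "\<beta> \<in> idx k" "\<alpha> \<noteq> \<beta>"
  shows "\<delta> powi k / (2 * A0) \<le> d (new_pt \<omega> k \<alpha>) (new_pt \<omega> k \<beta>)"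
proof -
  consider "new_pt \<omega> k \<alpha> = pt k \<alpha>" | "new_pt \<omega> k \<beta> = pt k \<beta>"
    | "new_pt \<omega> k \<alpha> \<noteq> pt k \<alpha>" "new_pt \<omega> k \<beta> \<noteq> pt k \<beta>" by blast
  then show ?thesis
  proof cases
    case 1
    then show ?thesis using new_pt_pt_far[OF assms(2,1), of \<omega>] assms(3) by (metis d_sym)
  next
    case 2
    then show ?thesis using new_pt_pt_far[OF assms(1,2,3), of \<omega>] by simp
  next
    case 3
    obtain \<gamma> where \<gamma>: "\<gamma> \<in> children k \<alpha>" "new_pt \<omega> k \<alpha> = pt (k + 1) \<gamma>" "label1 k \<alpha> = fst (\<omega> k)"
      using new_pt_child[OF assms(1), of \<omega>] 3 by blast
    obtain \<theta> where \<theta>: "\<theta> \<in> children k \<beta>" "new_pt \<omega> k \<beta> = pt (k + 1) \<theta>" "label1 k \<beta> = fst (\<omega> k)"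
      using new_pt_child[OF assms(2), of \<omega>] 3 by blast
    have "\<beta> \<notin> neighbours k \<alpha>" using label1_neighbours[OF assms(1), of \<beta>] \<gamma>(3) \<theta>(3) by auto
    then have "\<not> d (pt (k + 1) \<gamma>) (pt (k + 1) \<theta>) < inverse (2 * A0) * \<delta> powi k"
      using \<gamma>(1) \<theta>(1) assms by (auto simp: neighbours_def)
    then show ?thesis using \<gamma>(2) \<theta>(2) by (simp add: field_simps)
  qed
qed

section \<open>New parents\<close>

definition near :: "(int \<Rightarrow> nat \<times> nat) \<Rightarrow> int \<Rightarrow> 'i \<Rightarrow> 'i \<Rightarrow> bool" where
  "near \<omega> k \<beta> \<alpha> \<longleftrightarrow> \<alpha> \<in> idx k \<and> d (pt (k + 1) \<beta>) (new_pt \<omega> k \<alpha>) < \<delta> powi k / (4 * A0\<^sup>2)"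

text \<open>The quasi-triangle inequality turns two distances below \<delta>^k / (4 A0^2) into one
  below \<delta>^k / (2 A0), which is exactly the separation of the new points.\<close>

lemma near_unique:
  assumes "near \<omega> k \<beta> \<alpha>" "near \<omega> k \<beta> \<alpha>'"
  shows "\<alpha> = \<alpha>'"
proof (rule ccontr)
  assume "\<alpha> \<noteq> \<alpha>'"
  then have "\<delta> powi k / (2 * A0) \<le> d (new_pt \<omega> k \<alpha>) (new_pt \<omega> k \<alpha>')"
    using assms by (intro new_pt_separated) (auto simp: near_def)
  also have "\<dots> < A0 * (\<delta> powi k / (4 * A0\<^sup>2) + \<delta> powi k / (4 * A0\<^sup>2))"
    using assms by (intro quasi_triangle_less[of _ "pt (k + 1) \<beta>"]) (auto simp: near_def d_sym)
  also have "\<dots> = \<delta> powi k / (2 * A0)"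
    using A0_pos by (simp add: field_simps power2_eq_square)
  finally show False by simp
qed

text \<open>Functional form of \<open>new_step\<close>: \<open>near\<close> takes precedence, the
  reference parent is the fallback, and \<open>near_unique\<close> justifies
  \<open>THE\<close>.\<close>

definition new_par :: "(int \<Rightarrow> nat \<times> nat) \<Rightarrow> int \<Rightarrow> 'i \<Rightarrow> 'i" where
  "new_par \<omega> k \<beta> = (if \<exists>\<alpha>. near \<omega> k \<beta> \<alpha> then THE \<alpha>. near \<omega> k \<beta> \<alpha> else par k \<beta>)"

lemma new_par_near: "near \<omega> k \<beta> \<alpha> \<Longrightarrow> new_par \<omega> k \<beta> = \<alpha>"
  unfolding new_par_def using near_unique by (auto intro!: the_equality)

lemma new_par_idx:
  assumes "\<beta> \<in> idx (k + 1)"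
  shows "new_par \<omega> k \<beta> \<in> idx k"
proof (cases "\<exists>\<alpha>. near \<omega> k \<beta> \<alpha>")
  case True
  then show ?thesis using new_par_near near_def by metis
next
  case False
  then show ?thesis using par_idx[OF assms] by (simp add: new_par_def)
qed

lemma new_step_iff:
  "((l, \<beta>), (k, \<alpha>)) \<in> new_step \<omega> \<longleftrightarrow> l = k + 1 \<and> \<beta> \<in> idx l \<and> \<alpha> = new_par \<omega> k \<beta>"
proof -
  have c: "1 / 4 * A0 powi (-2) * \<delta> powi k = \<delta> powi k / (4 * A0\<^sup>2)" for k
    by (simp add: power_int_def divide_simps)
  have "((l, \<beta>), (k, \<alpha>)) \<in> new_step \<omega> \<longleftrightarrow> l = k + 1 \<and> \<alpha> \<in> idx k \<and> \<beta> \<in> idx (k + 1) \<and>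
      (near \<omega> k \<beta> \<alpha> \<or> par k \<beta> = \<alpha> \<and> \<not> (\<exists>\<gamma>. near \<omega> k \<beta> \<gamma>))"
    unfolding new_step_def near_def children_def c by auto
  also have "\<dots> \<longleftrightarrow> l = k + 1 \<and> \<beta> \<in> idx l \<and> \<alpha> = new_par \<omega> k \<beta>"
    using new_par_near par_idx new_par_idx[of \<beta> k \<omega>] by (metis new_par_def)
  finally show ?thesis .
qed

text \<open>The constant is 1/4 + 2: a near parent costs A0 (1 / (4 A0^2) + 2 A0) = 1 / (4 A0) + 2
  A0^2, and the reference parent only 2 A0.\<close>

lemma new_par_dist:
  assumes "\<beta> \<in> idx (k + 1)"
  shows "d (pt (k + 1) \<beta>) (pt k (new_par \<omega> k \<beta>)) < 9 / 4 * A0\<^sup>2 * \<delta> powi k"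
proof (cases "\<exists>\<alpha>. near \<omega> k \<beta> \<alpha>")
  case True
  then obtain \<alpha> where \<alpha>: "near \<omega> k \<beta> \<alpha>" by blast
  have "d (pt (k + 1) \<beta>) (pt k \<alpha>) < A0 * (\<delta> powi k / (4 * A0\<^sup>2) + 2 * A0 * \<delta> powi k)"
    using \<alpha> new_pt_dist[of \<alpha> k \<omega>]
    by (intro quasi_triangle_less[of _ "new_pt \<omega> k \<alpha>"]) (auto simp: near_def)
  also have "\<dots> = (1 / (4 * A0) + 2 * A0\<^sup>2) * \<delta> powi k"
    using A0_pos by (simp add: field_simps power2_eq_square)
  also have "\<dots> \<le> 9 / 4 * A0\<^sup>2 * \<delta> powi k"
  proof (rule mult_right_mono)
    have "1 / A0 \<le> 1" "1 \<le> A0\<^sup>2" using A0_ge_1 by (auto simp: one_le_power)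
    then show "1 / (4 * A0) + 2 * A0\<^sup>2 \<le> 9 / 4 * A0\<^sup>2" by simp
  qed (simp add: less_imp_le)
  finally show ?thesis using new_par_near[OF \<alpha>] by simp
next
  case False
  have "d (pt (k + 1) \<beta>) (pt k (par k \<beta>)) < 2 * A0 * \<delta> powi k"
    using par_dist[OF assms] .
  also have "\<dots> \<le> 9 / 4 * A0\<^sup>2 * \<delta> powi k"
  proof (rule mult_right_mono)
    have "A0 * 1 \<le> A0 * A0" using A0_ge_1 by (intro mult_left_mono) auto
    then show "2 * A0 \<le> 9 / 4 * A0\<^sup>2" using A0_pos unfolding power2_eq_square by linarith
  qed (simp add: less_imp_le)
  finally show ?thesis using False by (simp add: new_par_def)
qed

lemma finite_new_children: "finite {\<beta> \<in> idx (k + 1). new_par \<omega> k \<beta> = \<alpha>}"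
  by (rule finite_subset[OF _ finite_idx_near[of "k + 1" "pt k \<alpha>" "9 / 4 * A0\<^sup>2 * \<delta> powi k"]])
     (auto simp: d_sym dest: new_par_dist)

text \<open>Here closeness is to the reference point, so the conclusion holds for all \<omega> at
  once. A competing near index would have its new point too close to a foreign reference point;
  without one, \<open>par_close\<close> decides.\<close>

lemma new_par_near_pt:
  assumes "\<beta> \<in> idx (k + 1)" "\<alpha> \<in> idx k" "d (pt (k + 1) \<beta>) (pt k \<alpha>) < \<delta> powi k / (4 * A0\<^sup>2)"
  shows "new_par \<omega> k \<beta> = \<alpha>"
proof (cases "\<exists>\<gamma>. near \<omega> k \<beta> \<gamma>")
  case True
  then obtain \<gamma> where \<gamma>: "near \<omega> k \<beta> \<gamma>" by blast
  have "\<gamma> = \<alpha>"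
  proof (rule ccontr)
    assume "\<gamma> \<noteq> \<alpha>"
    then have "\<delta> powi k / (2 * A0) \<le> d (new_pt \<omega> k \<gamma>) (pt k \<alpha>)"
      using \<gamma> assms by (intro new_pt_pt_far) (auto simp: near_def)
    also have "\<dots> < A0 * (\<delta> powi k / (4 * A0\<^sup>2) + \<delta> powi k / (4 * A0\<^sup>2))"
      using \<gamma> assms by (intro quasi_triangle_less[of _ "pt (k + 1) \<beta>"]) (auto simp: near_def d_sym)
    also have "\<dots> = \<delta> powi k / (2 * A0)"
      using A0_pos by (simp add: field_simps power2_eq_square)
    finally show False by simp
  qed
  then show ?thesis using new_par_near[OF \<gamma>] by simp
next
  case False
  have "\<delta> powi k / (4 * A0\<^sup>2) \<le> 1 / (2 * A0) * \<delta> powi k"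
  proof -
    have "A0 * 1 \<le> A0 * A0" using A0_ge_1 by (intro mult_left_mono) auto
    then have "2 * A0 \<le> 4 * A0\<^sup>2" using A0_pos unfolding power2_eq_square by linarith
    then show ?thesis using A0_pos by (simp add: frac_le less_imp_le)
  qed
  then have "par k \<beta> = \<alpha>" using assms by (intro par_close) auto
  then show ?thesis using False by (simp add: new_par_def)
qed

text \<open>The level \<open>k\<close> is that of the result; \<open>\<beta>\<close> lives n levels
  deeper, at \<open>k + n\<close>. The recursion peels off the coarsest step,
  \<open>ancestor_Suc\<close> the finest.\<close>

primrec ancestor :: "(int \<Rightarrow> nat \<times> nat) \<Rightarrow> nat \<Rightarrow> int \<Rightarrow> 'i \<Rightarrow> 'i" where
  "ancestor \<omega> 0 k \<beta> = \<beta>"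
| "ancestor \<omega> (Suc n) k \<beta> = new_par \<omega> k (ancestor \<omega> n (k + 1) \<beta>)"

lemma ancestor_idx: "\<beta> \<in> idx (k + int n) \<Longrightarrow> ancestor \<omega> n k \<beta> \<in> idx k"
proof (induction n arbitrary: k)
  case (Suc n)
  then show ?case using Suc.IH[of "k + 1"] by (auto intro!: new_par_idx simp: algebra_simps)
qed simp

lemma ancestor_add: "ancestor \<omega> (m + n) k \<beta> = ancestor \<omega> m k (ancestor \<omega> n (k + int m) \<beta>)"
  by (induction m arbitrary: k) (auto simp: algebra_simps)

lemma ancestor_Suc: "ancestor \<omega> (Suc n) k \<beta> = ancestor \<omega> n k (new_par \<omega> (k + int n) \<beta>)"
  using ancestor_add[of \<omega> n "Suc 0" k \<beta>] by simp

text \<open>The bound does not grow with n: the distance accumulated below level k + 1 carries a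
  factor \<open>\<delta>\<close>, and 5/2 \<open>\<delta>\<close> A0 + 9/4 stays below 5/2.\<close>

lemma ancestor_dist:
  "\<beta> \<in> idx (k + int n) \<Longrightarrow>
    d (pt (k + int n) \<beta>) (pt k (ancestor \<omega> n k \<beta>)) \<le> 5 / 2 * A0 ^ 3 * \<delta> powi k"
proof (induction n arbitrary: k)
  case 0
  then show ?case using A0_pos \<delta>_pos by simp
next
  case (Suc n)
  have \<beta>: "\<beta> \<in> idx (k + 1 + int n)" using Suc.prems by (simp add: algebra_simps)
  have "d (pt (k + 1 + int n) \<beta>) (pt k (ancestor \<omega> (Suc n) k \<beta>))
      \<le> A0 * (5 / 2 * A0 ^ 3 * \<delta> powi (k + 1) + 9 / 4 * A0\<^sup>2 * \<delta> powi k)"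
    using Suc.IH[OF \<beta>] new_par_dist[OF ancestor_idx[OF \<beta>], of \<omega> \<omega>]
    by (intro quasi_triangle_le[of _ "pt (k + 1) (ancestor \<omega> n (k + 1) \<beta>)"]) auto
  also have "\<dots> = (5 / 2 * (\<delta> * A0 ^ 1) + 9 / 4) * A0 ^ 3 * \<delta> powi k"
    unfolding scale_Suc by (simp add: algebra_simps power3_eq_cube power2_eq_square)
  also have "\<dots> \<le> 5 / 2 * A0 ^ 3 * \<delta> powi k"
    using \<delta>_A0[of 1] A0_pos by (intro mult_right_mono) (auto simp: less_imp_le algebra_simps)
  finally show ?case by (simp add: algebra_simps)
qed

text \<open>Since each index has a single new parent, the reflexive transitive closure is iteration
  of \<open>new_par\<close>.\<close>

lemma new_order_iff:
  assumes "\<beta> \<in> idx l"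
  shows "((l, \<beta>), (k, \<alpha>)) \<in> new_order \<omega> \<longleftrightarrow> (\<exists>n. l = k + int n \<and> \<alpha> = ancestor \<omega> n k \<beta>)"
proof
  assume "((l, \<beta>), (k, \<alpha>)) \<in> new_order \<omega>"
  then show "\<exists>n. l = k + int n \<and> \<alpha> = ancestor \<omega> n k \<beta>"
    unfolding new_order_def
  proof (induction rule: rtrancl_induct2)
    case refl
    then show ?case by (auto intro!: exI[of _ 0])
  next
    case (step k' \<alpha>' k \<alpha>)
    then obtain n where "l = k' + int n" "\<alpha>' = ancestor \<omega> n k' \<beta>" by blast
    moreover have "k' = k + 1" "\<alpha> = new_par \<omega> k \<alpha>'" using step(2) by (auto simp: new_step_iff)
    ultimately show ?case by (intro exI[of _ "Suc n"]) auto
  qed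
next
  assume "\<exists>n. l = k + int n \<and> \<alpha> = ancestor \<omega> n k \<beta>"
  then obtain n where "l = k + int n" "\<alpha> = ancestor \<omega> n k \<beta>" by blast
  then show "((l, \<beta>), (k, \<alpha>)) \<in> new_order \<omega>"
  proof (induction n arbitrary: k \<alpha>)
    case 0
    then show ?case by (simp add: new_order_def)
  next
    case (Suc n)
    have "((l, \<beta>), (k + 1, ancestor \<omega> n (k + 1) \<beta>)) \<in> new_order \<omega>"
      using Suc by simp
    moreover have "((k + 1, ancestor \<omega> n (k + 1) \<beta>), (k, \<alpha>)) \<in> new_step \<omega>"
      using Suc.prems assms ancestor_idx[of \<beta> "k + 1" n \<omega>] by (simp add: new_step_iff add.assoc)
    ultimately show ?case unfolding new_order_def by (rule rtrancl.rtrancl_into_rtrancl)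
  qed
qed

section \<open>Cubes: inner and outer balls, disjointness, covering, refinement\<close>

lemma pre_cube_iff:
  "y \<in> pre_cube \<omega> k \<alpha> \<longleftrightarrow>
    (\<exists>n. \<exists>\<gamma>\<in>idx (k + int n). ancestor \<omega> n k \<gamma> = \<alpha> \<and> y = new_pt \<omega> (k + int n) \<gamma>)"
  unfolding pre_cube_def mem_Collect_eq using new_order_iff by (metis (no_types, opaque_lifting))

lemma closed_cube_iff: "x \<in> closed_cube \<omega> k \<alpha> \<longleftrightarrow> (\<forall>r>0. \<exists>y\<in>pre_cube \<omega> k \<alpha>. d x y < r)"
  by (simp add: closed_cube_def closure_of_qtop)

text \<open>The ancestor at level l + 1 is within 5/2 A0^3 \<delta>^(l+1) of the deep point. This is
  negligible against \<delta>^l / A0^3, so that ancestor is still near the new point of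
  \<open>\<beta>\<close>.\<close>

lemma near_ancestor:
  assumes "\<beta> \<in> idx l" "\<gamma> \<in> idx (l + 1 + int n)"
    and "d (pt (l + 1 + int n) \<gamma>) (new_pt \<omega> l \<beta>) < \<delta> powi l / (8 * A0 ^ 3)"
  shows "ancestor \<omega> (Suc n) l \<gamma> = \<beta>"
proof -
  let ?\<theta> = "ancestor \<omega> n (l + 1) \<gamma>"
  have "d (new_pt \<omega> l \<beta>) (pt (l + 1) ?\<theta>)
      < A0 * (\<delta> powi l / (8 * A0 ^ 3) + 5 / 2 * A0 ^ 3 * \<delta> powi (l + 1))"
    using assms ancestor_dist[OF assms(2), of \<omega>]
    by (intro quasi_triangle_less[of _ "pt (l + 1 + int n) \<gamma>"]) (auto simp: d_sym)
  also have "\<dots> = (1 / 8 + 5 / 2 * (\<delta> * A0 ^ 6)) * (\<delta> powi l / A0\<^sup>2)"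
    unfolding scale_Suc using A0_pos by (simp add: field_simps eval_nat_numeral)
  also have "\<dots> \<le> 1 / 4 * (\<delta> powi l / A0\<^sup>2)"
    using \<delta>_A0[of 6] A0_pos by (intro mult_right_mono) (auto simp: less_imp_le)
  finally have "near \<omega> l ?\<theta> \<beta>" using assms(1) by (simp add: near_def d_sym)
  then show ?thesis by (simp add: new_par_near)
qed

text \<open>Counterpart for balls around reference points. The ancestor at level k + 1 is within
  \<delta>^k / (8 A0^3) of x, and another 1/8 comes from x itself; together they give the 1/4
  required by \<open>new_par_near_pt\<close>.\<close>

lemma near_pt_ancestor:
  assumes "\<alpha> \<in> idx k" "\<gamma> \<in> idx (k + 1 + int n)"
    and "d (pt k \<alpha>) x < \<delta> powi k / (8 * A0 ^ 3)" "d x (pt (k + 1 + int n) \<gamma>) \<le> \<delta> powi (k + 1)"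
  shows "ancestor \<omega> (Suc n) k \<gamma> = \<alpha>"
proof -
  let ?\<theta> = "ancestor \<omega> n (k + 1) \<gamma>"
  have "d x (pt (k + 1) ?\<theta>) \<le> A0 * (\<delta> powi (k + 1) + 5 / 2 * A0 ^ 3 * \<delta> powi (k + 1))"
    using assms ancestor_dist[OF assms(2), of \<omega>] by (intro quasi_triangle_le)
  also have "\<dots> = (\<delta> * A0 ^ 4 + 5 / 2 * (\<delta> * A0 ^ 7)) * (\<delta> powi k / A0 ^ 3)"
    unfolding scale_Suc using A0_pos by (simp add: field_simps eval_nat_numeral)
  also have "\<dots> \<le> 1 / 8 * (\<delta> powi k / A0 ^ 3)"
    using \<delta>_A0[of 4] \<delta>_A0[of 7] A0_pos by (intro mult_right_mono) (auto simp: less_imp_le)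
  finally have "d (pt k \<alpha>) (pt (k + 1) ?\<theta>)
      < A0 * (\<delta> powi k / (8 * A0 ^ 3) + 1 / 8 * (\<delta> powi k / A0 ^ 3))"
    using assms(3) by (intro quasi_triangle_less)
  also have "\<dots> = \<delta> powi k / (4 * A0\<^sup>2)"
    using A0_pos by (simp add: field_simps eval_nat_numeral)
  finally have "new_par \<omega> k ?\<theta> = \<alpha>"
    using assms by (intro new_par_near_pt) (auto simp: d_sym intro!: ancestor_idx)
  then show ?thesis by simp
qed

text \<open>Allows a new point to be treated as a reference point one level deeper that descends
  from the same index.\<close>

lemma new_pt_new_child:
  assumes "\<alpha> \<in> idx k"
  shows "\<exists>\<gamma>\<in>idx (k + 1). new_pt \<omega> k \<alpha> = pt (k + 1) \<gamma> \<and> new_par \<omega> k \<gamma> = \<alpha>"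
proof -
  obtain \<gamma> where \<gamma>: "\<gamma> \<in> children k \<alpha>" "new_pt \<omega> k \<alpha> = pt (k + 1) \<gamma>"
    using new_pt_child[OF assms, of \<omega>] by blast
  then have "near \<omega> k \<gamma> \<alpha>" using assms A0_pos by (simp add: near_def)
  then show ?thesis using \<gamma> new_par_near by (auto simp: children_def)
qed

text \<open>Points of the pre-cube are reference points descending from \<open>\<alpha>\<close>, so
  \<open>ancestor_dist\<close> bounds them. Passing to the closure costs one more quasi-triangle
  inequality, giving A0 + 5/2 A0^4, well below 8 A0^5.\<close>

lemma closed_cube_bounded:
  assumes "\<alpha> \<in> idx k" "x \<in> closed_cube \<omega> k \<alpha>"
  shows "d (pt k \<alpha>) x < 8 * A0 ^ 5 * \<delta> powi k"
proof -
  obtain y where y: "y \<in> pre_cube \<omega> k \<alpha>" "d x y < \<delta> powi k"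
    using assms(2) scale_pos unfolding closed_cube_iff by blast
  then obtain n \<gamma> where \<gamma>: "\<gamma> \<in> idx (k + int n)" "ancestor \<omega> n k \<gamma> = \<alpha>" "y = new_pt \<omega> (k + int n) \<gamma>"
    unfolding pre_cube_iff by blast
  then obtain \<theta> where \<theta>: "\<theta> \<in> idx (k + int n + 1)" "y = pt (k + int n + 1) \<theta>"
      "new_par \<omega> (k + int n) \<theta> = \<gamma>"
    using new_pt_new_child by metis
  have eq: "k + int (Suc n) = k + int n + 1" by simp
  have "d y (pt k \<alpha>) \<le> 5 / 2 * A0 ^ 3 * \<delta> powi k"
    using ancestor_dist[of \<theta> k "Suc n" \<omega>, unfolded eq ancestor_Suc] \<theta> \<gamma>(2) by simp
  then have "d x (pt k \<alpha>) < A0 * (\<delta> powi k + 5 / 2 * A0 ^ 3 * \<delta> powi k)"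
    using y(2) by (intro quasi_triangle_less)
  also have "\<dots> = (A0 ^ 1 + 5 / 2 * A0 ^ 4) * \<delta> powi k"
    by (simp add: algebra_simps eval_nat_numeral)
  also have "\<dots> \<le> 8 * A0 ^ 5 * \<delta> powi k"
  proof (rule mult_right_mono)
    have "A0 ^ n \<le> A0 ^ 5" if "n \<le> 5" for n
      using A0_ge_1 that by (rule power_increasing[rotated])
    from this[of 1] this[of 4] have "A0 ^ 1 \<le> A0 ^ 5" "A0 ^ 4 \<le> A0 ^ 5" "0 \<le> A0 ^ 5"
      using A0_pos by auto
    then show "A0 ^ 1 + 5 / 2 * A0 ^ 4 \<le> 8 * A0 ^ 5" by linarith
  qed (simp add: less_imp_le)
  finally show ?thesis by (simp add: d_sym)
qed

text \<open>The coarser new point captures the finer one. Rewriting the finer one as a reference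
  point of level k + n + 1 puts it strictly below level k + m, so that \<open>near_ancestor\<close>
  applies even when m = n.\<close>

lemma new_pt_close_ancestor:
  assumes "\<gamma> \<in> idx (k + int m)" "\<theta> \<in> idx (k + int n)" "m \<le> n"
    and "d (new_pt \<omega> (k + int m) \<gamma>) (new_pt \<omega> (k + int n) \<theta>) < \<delta> powi (k + int m) / (8 * A0 ^ 3)"
  shows "ancestor \<omega> m k \<gamma> = ancestor \<omega> n k \<theta>"
proof -
  obtain j where n: "n = m + j" using assms(3) le_Suc_ex by blast
  obtain \<theta>' where \<theta>': "\<theta>' \<in> idx (k + int n + 1)"
      "new_pt \<omega> (k + int n) \<theta> = pt (k + int n + 1) \<theta>'" "new_par \<omega> (k + int n) \<theta>' = \<theta>"
    using new_pt_new_child[OF assms(2)] by blast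
  have l: "k + int n + 1 = k + int m + 1 + int j" using n by simp
  have "ancestor \<omega> (Suc j) (k + int m) \<theta>' = \<gamma>"
    using \<theta>' assms(1,4) unfolding l by (intro near_ancestor) (auto simp: d_sym)
  moreover have "ancestor \<omega> (m + Suc j) k \<theta>' = ancestor \<omega> n k \<theta>"
    using ancestor_Suc[of \<omega> n k \<theta>'] \<theta>'(3) n by simp
  ultimately show ?thesis using ancestor_add[of \<omega> m "Suc j" k \<theta>'] by simp
qed

lemma pre_cube_closed_cube_disjoint:
  assumes "y \<in> pre_cube \<omega> k \<beta>" "y \<in> closed_cube \<omega> k \<alpha>"
  shows "\<alpha> = \<beta>"
proof -
  obtain m \<gamma> where \<gamma>: "\<gamma> \<in> idx (k + int m)" "ancestor \<omega> m k \<gamma> = \<beta>" "y = new_pt \<omega> (k + int m) \<gamma>"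
    using assms(1) unfolding pre_cube_iff by blast
  \<comment> \<open>The tolerance is taken from the level of y. Should v come from a coarser level,
    that level allows an even larger distance, and the roles are exchanged.\<close>
  obtain v where v: "v \<in> pre_cube \<omega> k \<alpha>" "d y v < \<delta> powi (k + int m) / (8 * A0 ^ 3)"
    using assms(2) A0_pos scale_pos[of "k + int m"] unfolding closed_cube_iff
    by (metis divide_pos_pos mult_pos_pos zero_less_numeral zero_less_power)
  then obtain n \<theta> where \<theta>: "\<theta> \<in> idx (k + int n)" "ancestor \<omega> n k \<theta> = \<alpha>" "v = new_pt \<omega> (k + int n) \<theta>"
    unfolding pre_cube_iff by blast
  show ?thesis
  proof (cases "m \<le> n")
    case True
    then show ?thesis using new_pt_close_ancestor[OF \<gamma>(1) \<theta>(1), of \<omega>] v(2) \<gamma> \<theta> by simp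
  next
    case False
    have "\<delta> powi (k + int m) / (8 * A0 ^ 3) \<le> \<delta> powi (k + int n) / (8 * A0 ^ 3)"
      using A0_pos False by (intro divide_right_mono scale_mono) auto
    then show ?thesis
      using False new_pt_close_ancestor[OF \<theta>(1) \<gamma>(1), of \<omega>] v(2) \<gamma> \<theta> by (simp add: d_sym)
  qed
qed

text \<open>New points attached to the given reference points lie within A0 (1 + 2 A0)
  \<delta>^(k+n) of x. Infinitely many levels suffice, which is all that a pigeonhole argument
  provides.\<close>

lemma closed_cube_limit:
  assumes inf: "infinite {n. \<exists>\<gamma>\<in>idx (k + int n). ancestor \<omega> n k \<gamma> = \<alpha> \<and>
      d x (pt (k + int n) \<gamma>) < \<delta> powi (k + int n)}"
  shows "x \<in> closed_cube \<omega> k \<alpha>"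
  unfolding closed_cube_iff
proof (intro allI impI)
  fix r :: real assume "r > 0"
  have "(\<lambda>n. A0 * (1 + 2 * A0) * \<delta> powi k * \<delta> powi int n) \<longlonglongrightarrow> A0 * (1 + 2 * A0) * \<delta> powi k * 0"
    by (intro tendsto_mult_left scale_tendsto)
  then have "eventually (\<lambda>n. A0 * (1 + 2 * A0) * \<delta> powi k * \<delta> powi int n < r) sequentially"
    using \<open>r > 0\<close> by (auto dest: order_tendstoD(2))
  then obtain N where N: "\<And>n. n \<ge> N \<Longrightarrow> A0 * (1 + 2 * A0) * \<delta> powi k * \<delta> powi int n < r"
    unfolding eventually_sequentially by blast
  obtain n \<gamma> where n: "n \<ge> N" and \<gamma>: "\<gamma> \<in> idx (k + int n)" "ancestor \<omega> n k \<gamma> = \<alpha>"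
      "d x (pt (k + int n) \<gamma>) < \<delta> powi (k + int n)"
    using inf unfolding infinite_nat_iff_unbounded_le by blast
  have "d x (new_pt \<omega> (k + int n) \<gamma>) < A0 * (\<delta> powi (k + int n) + 2 * A0 * \<delta> powi (k + int n))"
    using \<gamma> new_pt_dist[OF \<gamma>(1), of \<omega>]
    by (intro quasi_triangle_less[of _ "pt (k + int n) \<gamma>"]) (auto simp: d_sym)
  also have "\<dots> = A0 * (1 + 2 * A0) * \<delta> powi k * \<delta> powi int n"
    using \<delta>_pos by (simp add: power_int_add algebra_simps)
  also have "\<dots> < r" using N[OF n] .
  finally have "d x (new_pt \<omega> (k + int n) \<gamma>) < r" .
  moreover have "new_pt \<omega> (k + int n) \<gamma> \<in> pre_cube \<omega> k \<alpha>"
    using \<gamma>(1,2) by (auto simp: pre_cube_iff)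
  ultimately show "\<exists>y\<in>pre_cube \<omega> k \<alpha>. d x y < r" by blast
qed

text \<open>Choose at every deep level a reference point close to x. The ancestors at level k stay
  within a fixed distance \<open>R\<close> of x, hence take finitely many values, and one value
  recurs infinitely often.\<close>

lemma closed_cube_cover: "\<exists>\<alpha>\<in>idx k. x \<in> closed_cube \<omega> k \<alpha>"
proof -
  \<comment> \<open>Only levels k + n at or above 0, where \<open>pt_dense\<close> is
    available.\<close>
  define A where "A = {n. 0 \<le> k + int n}"
  have "{nat (- k)..} \<subseteq> A" by (auto simp: A_def)
  then have A: "infinite A" using infinite_Ici infinite_super by blast
  obtain g where g: "\<And>n. n \<in> A \<Longrightarrow> g n \<in> idx (k + int n) \<and> d x (pt (k + int n) (g n)) < \<delta> powi (k + int n)"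
    using pt_dense[of "k + int _" x] unfolding A_def mem_Collect_eq by metis
  define f where "f n = ancestor \<omega> n k (g n)" for n
  define R where "R = A0 * (\<delta> powi k + 5 / 2 * A0 ^ 3 * \<delta> powi k)"
  have "f n \<in> {\<alpha> \<in> idx k. d x (pt k \<alpha>) < R}" if "n \<in> A" for n
  proof -
    have "d x (pt (k + int n) (g n)) < \<delta> powi k"
      using g[OF that] scale_mono[of k "k + int n"] by simp
    then have "d x (pt k (f n)) < R"
      unfolding R_def f_def using g[OF that] ancestor_dist[of "g n" k n \<omega>]
      by (intro quasi_triangle_less) auto
    then show ?thesis using g[OF that] ancestor_idx by (simp add: f_def)
  qed
  then have "finite (f ` A)" by (intro finite_subset[OF _ finite_idx_near[of k x R]]) auto
  from pigeonhole_infinite[OF A this] obtain n where n: "n \<in> A" "infinite {a \<in> A. f a = f n}" by blast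
  have "x \<in> closed_cube \<omega> k (f n)"
    by (intro closed_cube_limit infinite_super[OF _ n(2)]) (auto simp: f_def dest: g)
  moreover have "f n \<in> idx k" using g[OF n(1)] ancestor_idx by (simp add: f_def)
  ultimately show ?thesis by blast
qed

lemma ball_subset_closed_cube:
  assumes "\<alpha> \<in> idx k" "d (pt k \<alpha>) x < \<delta> powi k / (8 * A0 ^ 3)"
  shows "x \<in> closed_cube \<omega> k \<alpha>"
proof (rule closed_cube_limit, rule infinite_super)
  \<comment> \<open>From this index on, the level is nonnegative and at least one generation below
    k, as \<open>pt_dense\<close> and \<open>near_pt_ancestor\<close> require.\<close>
  show "infinite {Suc (nat (- k))..}" by (rule infinite_Ici)
  show "{Suc (nat (- k))..} \<subseteq> {n. \<exists>\<gamma>\<in>idx (k + int n). ancestor \<omega> n k \<gamma> = \<alpha> \<and>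
      d x (pt (k + int n) \<gamma>) < \<delta> powi (k + int n)}"
  proof
    fix m assume "m \<in> {Suc (nat (- k))..}"
    then obtain n where m: "m = Suc n" "0 \<le> k + 1 + int n" by (cases m) auto
    obtain \<gamma> where \<gamma>: "\<gamma> \<in> idx (k + 1 + int n)" "d x (pt (k + 1 + int n) \<gamma>) < \<delta> powi (k + 1 + int n)"
      using pt_dense[OF m(2)] by blast
    moreover have "\<delta> powi (k + 1 + int n) \<le> \<delta> powi (k + 1)" by (rule scale_mono) simp
    ultimately have "ancestor \<omega> m k \<gamma> = \<alpha>"
      unfolding m(1) using assms by (intro near_pt_ancestor) auto
    moreover have eq: "k + int m = k + 1 + int n" using m by simp
    ultimately show "m \<in> {n. \<exists>\<gamma>\<in>idx (k + int n). ancestor \<omega> n k \<gamma> = \<alpha> \<and>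
        d x (pt (k + int n) \<gamma>) < \<delta> powi (k + int n)}"
      using \<gamma> unfolding mem_Collect_eq eq by blast
  qed
qed

text \<open>The new point of \<open>\<alpha>\<close> is listed separately: it is a reference point
  of level k + 1, which may itself be replaced at that level. \<open>closed_cube_Suc\<close> absorbs
  it through the closure.\<close>

lemma pre_cube_Suc:
  assumes "\<alpha> \<in> idx k"
  shows "pre_cube \<omega> k \<alpha> =
    insert (new_pt \<omega> k \<alpha>) (\<Union>\<beta>\<in>{\<beta> \<in> idx (k + 1). new_par \<omega> k \<beta> = \<alpha>}. pre_cube \<omega> (k + 1) \<beta>)"
    (is "_ = insert _ ?U")
proof (intro set_eqI iffI)
  fix y assume "y \<in> pre_cube \<omega> k \<alpha>"
  then obtain n \<gamma> where \<gamma>: "\<gamma> \<in> idx (k + int n)" "ancestor \<omega> n k \<gamma> = \<alpha>" "y = new_pt \<omega> (k + int n) \<gamma>"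
    unfolding pre_cube_iff by blast
  show "y \<in> insert (new_pt \<omega> k \<alpha>) ?U"
  proof (cases n)
    case 0
    then show ?thesis using \<gamma> by simp
  next
    case (Suc j)
    then have *: "k + int n = k + 1 + int j" by simp
    have "ancestor \<omega> j (k + 1) \<gamma> \<in> idx (k + 1)" using \<gamma>(1) unfolding * by (rule ancestor_idx)
    moreover have "y \<in> pre_cube \<omega> (k + 1) (ancestor \<omega> j (k + 1) \<gamma>)"
      unfolding pre_cube_iff using \<gamma> * by auto
    ultimately show ?thesis using \<gamma>(2) Suc by auto
  qed
next
  fix y assume "y \<in> insert (new_pt \<omega> k \<alpha>) ?U"
  then consider "y = new_pt \<omega> k \<alpha>" | \<beta> where "new_par \<omega> k \<beta> = \<alpha>" "y \<in> pre_cube \<omega> (k + 1) \<beta>" by blast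
  then show "y \<in> pre_cube \<omega> k \<alpha>"
  proof cases
    case 1
    then show ?thesis unfolding pre_cube_iff using assms by (intro exI[of _ 0]) auto
  next
    case 2
    then obtain n \<gamma> where "\<gamma> \<in> idx (k + 1 + int n)" "ancestor \<omega> n (k + 1) \<gamma> = \<beta>"
        "y = new_pt \<omega> (k + 1 + int n) \<gamma>"
      unfolding pre_cube_iff by blast
    moreover have "k + 1 + int n = k + int (Suc n)" by simp
    ultimately show ?thesis unfolding pre_cube_iff using 2 by (intro exI[of _ "Suc n"]) auto
  qed
qed

text \<open>Finitely many new children make the union closed. The extra new point of
  \<open>\<alpha>\<close> lies in the union because it is the centre of the inner ball of a new
  child.\<close>

lemma closed_cube_Suc:
  assumes "\<alpha> \<in> idx k"
  shows "closed_cube \<omega> k \<alpha> =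
    (\<Union>\<beta>\<in>{\<beta> \<in> idx (k + 1). new_par \<omega> k \<beta> = \<alpha>}. closed_cube \<omega> (k + 1) \<beta>)" (is "_ = ?U")
proof
  have "closedin qtop ?U"
    using finite_new_children by (intro closedin_Union) (auto simp: closed_cube_def)
  moreover have "pre_cube \<omega> k \<alpha> \<subseteq> ?U"
  proof -
    obtain \<gamma> where \<gamma>: "\<gamma> \<in> idx (k + 1)" "new_pt \<omega> k \<alpha> = pt (k + 1) \<gamma>" "new_par \<omega> k \<gamma> = \<alpha>"
      using new_pt_new_child[OF assms] by blast
    then have "new_pt \<omega> k \<alpha> \<in> closed_cube \<omega> (k + 1) \<gamma>"
      using A0_pos by (intro ball_subset_closed_cube) auto
    moreover have "pre_cube \<omega> (k + 1) \<beta> \<subseteq> closed_cube \<omega> (k + 1) \<beta>" for \<beta>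
      unfolding closed_cube_def by (rule closure_of_subset) (simp add: topspace_qtop)
    ultimately show ?thesis unfolding pre_cube_Suc[OF assms] using \<gamma> by blast
  qed
  ultimately show "closed_cube \<omega> k \<alpha> \<subseteq> ?U"
    unfolding closed_cube_def by (intro closure_of_minimal)
  show "?U \<subseteq> closed_cube \<omega> k \<alpha>"
    unfolding closed_cube_def pre_cube_Suc[OF assms] by (intro UN_least closure_of_mono) auto
qed

end

section \<open>Measurability, independence and the splines\<close>

lemma sets_Collect_Bex_countable:
  assumes "countable I" "\<And>i. i \<in> I \<Longrightarrow> {x \<in> space M. P i x} \<in> sets M"
  shows "{x \<in> space M. \<exists>i\<in>I. P i x} \<in> sets M"
proof -
  have "{x \<in> space M. \<exists>i\<in>I. P i x} = (\<Union>i\<in>I. {x \<in> space M. P i x})" by auto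
  then show ?thesis using assms by (auto intro: sets.countable_UN'')
qed

section \<open>Measurability and independence of cube events\<close>

context random_dyadic_system
begin

definition label_space :: "(nat \<times> nat) measure" where
  "label_space = uniform_count_measure ({0..max_neighbours} \<times> {1..max_children})"

lemma prob_\<omega>_eq: "prob_\<omega> = (\<Pi>\<^sub>M k\<in>UNIV. label_space)"
  by (simp add: prob_\<omega>_def label_space_def)

lemma prob_space_label_space: "prob_space label_space"
proof -
  \<comment> \<open>The label set must be nonempty: any index at level 0 has its second label in
    {1..\<open>max_children\<close>}.\<close>
  fix x
  obtain \<beta> where "\<beta> \<in> idx 0" using pt_dense[of 0 x] by auto
  then have "max_children \<ge> 1" using label2_range[of \<beta> 0] by simp
  then show ?thesis
    unfolding label_space_def by (intro prob_space_uniform_count_measure) auto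
qed

lemma prob_space_prob_\<omega>: "prob_space prob_\<omega>"
  unfolding prob_\<omega>_eq by (intro prob_space_PiM prob_space_label_space)

lemma new_pt_cong: "\<omega> k = \<omega>' k \<Longrightarrow> new_pt \<omega> k \<alpha> = new_pt \<omega>' k \<alpha>"
  by (simp only: new_pt_def)

text \<open>Locality in \<omega>: new parents at level k read the coordinate k alone, while by
  \<open>closed_cube_cong\<close> cubes of level k + 1 read only later ones. Independence of the two
  rests on this.\<close>

lemma new_par_cong: "\<omega> k = \<omega>' k \<Longrightarrow> new_par \<omega> k \<beta> = new_par \<omega>' k \<beta>"
proof -
  assume "\<omega> k = \<omega>' k"
  then have "near \<omega> k = near \<omega>' k" using new_pt_cong[of \<omega> k \<omega>'] by (simp add: fun_eq_iff near_def)
  then show ?thesis by (simp only: new_par_def)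
qed

lemma ancestor_cong: "(\<And>l. k \<le> l \<Longrightarrow> \<omega> l = \<omega>' l) \<Longrightarrow> ancestor \<omega> n k \<beta> = ancestor \<omega>' n k \<beta>"
proof (induction n arbitrary: k)
  case (Suc n)
  then have "ancestor \<omega> n (k + 1) \<beta> = ancestor \<omega>' n (k + 1) \<beta>" by simp
  then show ?case using Suc.prems[of k] new_par_cong[of \<omega> k \<omega>'] by simp
qed simp

lemma closed_cube_cong:
  assumes "\<And>l. k \<le> l \<Longrightarrow> \<omega> l = \<omega>' l"
  shows "closed_cube \<omega> k \<alpha> = closed_cube \<omega>' k \<alpha>"
proof -
  have "new_pt \<omega> (k + int n) \<gamma> = new_pt \<omega>' (k + int n) \<gamma>" for n \<gamma>
    using assms by (intro new_pt_cong) simp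
  moreover have "ancestor \<omega> n k \<gamma> = ancestor \<omega>' n k \<gamma>" for n \<gamma>
    using assms by (rule ancestor_cong)
  ultimately have "pre_cube \<omega> k \<alpha> = pre_cube \<omega>' k \<alpha>"
    by (intro set_eqI) (simp add: pre_cube_iff)
  then show ?thesis by (simp add: closed_cube_def)
qed

lemma sets_coordinate:
  assumes "k \<in> K"
  shows "{\<omega> \<in> space (\<Pi>\<^sub>M k\<in>K. label_space). P (\<omega> k)} \<in> sets (\<Pi>\<^sub>M k\<in>K. label_space)"
proof -
  have eq: "{\<omega> \<in> space (\<Pi>\<^sub>M k\<in>K. label_space). P (\<omega> k)} =
      (\<lambda>\<omega>. \<omega> k) -` {s \<in> space label_space. P s} \<inter> space (\<Pi>\<^sub>M k\<in>K. label_space)"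
    using assms by (auto simp: space_PiM)
  have "{s \<in> space label_space. P s} \<in> sets label_space"
    by (auto simp: label_space_def sets_uniform_count_measure space_uniform_count_measure)
  then show ?thesis
    unfolding eq by (rule measurable_sets[OF measurable_component_singleton[OF assms]])
qed

lemma sets_new_par:
  assumes "k \<in> K"
  shows "{\<omega> \<in> space (\<Pi>\<^sub>M k\<in>K. label_space). new_par \<omega> k \<beta> = \<alpha>} \<in> sets (\<Pi>\<^sub>M k\<in>K. label_space)"
proof -
  \<comment> \<open>Replacing \<omega> by the constant sequence with value \<open>\<omega> k\<close>
    exhibits the event as a predicate of one coordinate.\<close>
  have "new_par \<omega> k \<beta> = new_par (\<lambda>_. \<omega> k) k \<beta>" for \<omega> by (rule new_par_cong) simp
  then show ?thesis using sets_coordinate[OF assms, of "\<lambda>s. new_par (\<lambda>_. s) k \<beta> = \<alpha>"] by simp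
qed

text \<open>The coordinate set \<open>K\<close> is left general so that the result serves both the
  whole space and the tail product over {k + 1..}.\<close>

lemma sets_ancestor:
  assumes "{k..} \<subseteq> K" "\<beta> \<in> idx (k + int n)"
  shows "{\<omega> \<in> space (\<Pi>\<^sub>M k\<in>K. label_space). ancestor \<omega> n k \<beta> = \<alpha>} \<in> sets (\<Pi>\<^sub>M k\<in>K. label_space)"
  using assms
proof (induction n arbitrary: k \<alpha>)
  case 0
  then show ?case by simp
next
  case (Suc n)
  have \<beta>: "\<beta> \<in> idx (k + 1 + int n)" using Suc.prems(2) by (simp add: add.assoc)
  have eq: "ancestor \<omega> (Suc n) k \<beta> = \<alpha> \<longleftrightarrow>
      (\<exists>\<gamma>\<in>idx (k + 1). ancestor \<omega> n (k + 1) \<beta> = \<gamma> \<and> new_par \<omega> k \<gamma> = \<alpha>)" for \<omega>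
    using ancestor_idx[OF \<beta>] by auto
  have "{k + 1..} \<subseteq> K" "k \<in> K" using Suc.prems(1) by auto
  then show ?case
    unfolding eq using \<beta>
    by (intro sets_Collect_Bex_countable sets.sets_Collect_conj Suc.IH sets_new_par countable_idx)
qed

lemma sets_closed_cube:
  assumes "{k..} \<subseteq> K"
  shows "{\<omega> \<in> space (\<Pi>\<^sub>M k\<in>K. label_space). x \<in> closed_cube \<omega> k \<alpha>} \<in> sets (\<Pi>\<^sub>M k\<in>K. label_space)"
proof -
  \<comment> \<open>Radii 1 / (j + 1) suffice, which leaves only countable quantifiers.\<close>
  have seq: "(\<forall>r>0. \<exists>y\<in>E. d x y < r) \<longleftrightarrow> (\<forall>j::nat. \<exists>y\<in>E. d x y < inverse (real (Suc j)))" for E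
    by (meson inverse_Suc less_trans reals_Archimedean)
  have new_pt: "new_pt \<omega> l \<gamma> = new_pt (\<lambda>_. \<omega> l) l \<gamma>" for \<omega> l \<gamma>
    by (rule new_pt_cong) simp
  have "(\<exists>y\<in>pre_cube \<omega> k \<alpha>. d x y < r) \<longleftrightarrow> (\<exists>n. \<exists>\<gamma>\<in>idx (k + int n).
      ancestor \<omega> n k \<gamma> = \<alpha> \<and> d x (new_pt (\<lambda>_. \<omega> (k + int n)) (k + int n) \<gamma>) < r)" for \<omega> r
    unfolding new_pt[symmetric] Bex_def pre_cube_iff by auto
  then have eq: "x \<in> closed_cube \<omega> k \<alpha> \<longleftrightarrow> (\<forall>j. \<exists>n. \<exists>\<gamma>\<in>idx (k + int n).
      ancestor \<omega> n k \<gamma> = \<alpha> \<and>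
      d x (new_pt (\<lambda>_. \<omega> (k + int n)) (k + int n) \<gamma>) < inverse (real (Suc j)))" for \<omega>
    unfolding closed_cube_iff seq by simp
  have near: "{\<omega> \<in> space (\<Pi>\<^sub>M k\<in>K. label_space).
      d x (new_pt (\<lambda>_. \<omega> (k + int n)) (k + int n) \<gamma>) < inverse (real (Suc j))} \<in> sets (\<Pi>\<^sub>M k\<in>K. label_space)"
    for n \<gamma> j
    using assms by (intro sets_coordinate) auto
  show ?thesis
    unfolding eq using assms
    by (intro sets.sets_Collect_countable_All sets.sets_Collect_countable_Ex
        sets_Collect_Bex_countable sets.sets_Collect_conj sets_ancestor countable_idx near)
qed

text \<open>Independence is equality of the joint law with the product of the marginals; here the
  joint map is the identity on the product space.\<close>

lemma indep_coordinates: "prob_space.indep_vars prob_\<omega> (\<lambda>_. label_space) (\<lambda>k \<omega>. \<omega> k) UNIV"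
proof -
  interpret prob_space prob_\<omega> by (rule prob_space_prob_\<omega>)
  have "distr prob_\<omega> (\<Pi>\<^sub>M k\<in>UNIV. label_space) (\<lambda>\<omega>. \<lambda>k\<in>UNIV. \<omega> k) = prob_\<omega>"
    by (simp add: prob_\<omega>_eq restrict_UNIV)
  moreover have "distr prob_\<omega> label_space (\<lambda>\<omega>. \<omega> k) = label_space" for k
    unfolding prob_\<omega>_eq by (intro distr_PiM_component prob_space_label_space) auto
  ultimately show ?thesis
    by (subst indep_vars_iff_distr_eq_PiM) (auto simp: prob_\<omega>_eq)
qed

text \<open>The two events are functions of the disjoint coordinate blocks {k} and {k +
  1..}.\<close>

lemma prob_new_par_closed_cube:
  "measure prob_\<omega> {\<omega> \<in> space prob_\<omega>. new_par \<omega> k \<beta> = \<alpha> \<and> x \<in> closed_cube \<omega> (k + 1) \<gamma>} =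
    measure prob_\<omega> {\<omega> \<in> space prob_\<omega>. new_par \<omega> k \<beta> = \<alpha>} * spline (k + 1) \<gamma> x"
proof -
  interpret prob_space prob_\<omega> by (rule prob_space_prob_\<omega>)
  \<comment> \<open>Restriction lands in the subproduct over \<open>K\<close>; by locality it does
    not change whether the respective event occurs.\<close>
  define F where "F K \<omega> = restrict (\<lambda>l. \<omega> l) K" for K and \<omega> :: "int \<Rightarrow> nat \<times> nat"
  define EA where "EA = {\<omega> \<in> space (\<Pi>\<^sub>M k\<in>{k}. label_space). new_par \<omega> k \<beta> = \<alpha>}"
  define EB where "EB = {\<omega> \<in> space (\<Pi>\<^sub>M k\<in>{k + 1..}. label_space). x \<in> closed_cube \<omega> (k + 1) \<gamma>}"
  have "indep_var (\<Pi>\<^sub>M k\<in>{k}. label_space) (F {k}) (\<Pi>\<^sub>M k\<in>{k + 1..}. label_space) (F {k + 1..})"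
    unfolding F_def by (rule indep_var_restrict[OF indep_coordinates]) auto
  then have "prob ((\<lambda>\<omega>. (F {k} \<omega>, F {k + 1..} \<omega>)) -` (EA \<times> EB) \<inter> space prob_\<omega>) =
      prob (F {k} -` EA \<inter> space prob_\<omega>) * prob (F {k + 1..} -` EB \<inter> space prob_\<omega>)"
    unfolding EA_def EB_def by (rule indep_varD) (auto intro: sets_new_par sets_closed_cube)
  moreover have A: "F {k} \<omega> \<in> EA \<longleftrightarrow> new_par \<omega> k \<beta> = \<alpha>" if "\<omega> \<in> space prob_\<omega>" for \<omega>
    using that new_par_cong[of "F {k} \<omega>" k \<omega>] by (auto simp: EA_def F_def prob_\<omega>_eq space_PiM)
  moreover have B: "F {k + 1..} \<omega> \<in> EB \<longleftrightarrow> x \<in> closed_cube \<omega> (k + 1) \<gamma>" if "\<omega> \<in> space prob_\<omega>" for \<omega>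
  proof -
    have "closed_cube (F {k + 1..} \<omega>) (k + 1) \<gamma> = closed_cube \<omega> (k + 1) \<gamma>"
      by (rule closed_cube_cong) (simp add: F_def)
    moreover have "F {k + 1..} \<omega> \<in> space (\<Pi>\<^sub>M k\<in>{k + 1..}. label_space)"
      using that by (auto simp: F_def prob_\<omega>_eq space_PiM)
    ultimately show ?thesis by (simp add: EB_def)
  qed
  moreover have "(\<lambda>\<omega>. (F {k} \<omega>, F {k + 1..} \<omega>)) -` (EA \<times> EB) \<inter> space prob_\<omega> =
      {\<omega> \<in> space prob_\<omega>. new_par \<omega> k \<beta> = \<alpha> \<and> x \<in> closed_cube \<omega> (k + 1) \<gamma>}"
    using A B by auto
  moreover have "F {k} -` EA \<inter> space prob_\<omega> = {\<omega> \<in> space prob_\<omega>. new_par \<omega> k \<beta> = \<alpha>}"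
    using A by auto
  moreover have "F {k + 1..} -` EB \<inter> space prob_\<omega> = {\<omega> \<in> space prob_\<omega>. x \<in> closed_cube \<omega> (k + 1) \<gamma>}"
    using B by auto
  ultimately show ?thesis by (simp add: spline_def)
qed

section \<open>Boundary layers and almost sure disjointness of closed cubes\<close>

lemma events_closed_cube: "{\<omega> \<in> space prob_\<omega>. x \<in> closed_cube \<omega> k \<alpha>} \<in> sets prob_\<omega>"
  unfolding prob_\<omega>_eq by (rule sets_closed_cube) simp

lemma events_new_par: "{\<omega> \<in> space prob_\<omega>. new_par \<omega> k \<beta> = \<alpha>} \<in> sets prob_\<omega>"
  unfolding prob_\<omega>_eq by (rule sets_new_par) simp

text \<open>The layer event may fail to be measurable, so the outer measure bound is transferred to
  measurable events contained in it.\<close>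

lemma boundary_exponent_bound:
  assumes "boundary_exponent \<eta>"
  obtains C where "0 < C" and
    "\<And>x k \<epsilon> E. 0 < \<epsilon> \<Longrightarrow> E \<in> sets prob_\<omega> \<Longrightarrow>
       (\<And>\<omega>. \<omega> \<in> E \<Longrightarrow> \<exists>\<alpha>\<in>idx k. x \<in> boundary_layer \<epsilon> \<omega> k \<alpha>) \<Longrightarrow> measure prob_\<omega> E \<le> C * \<epsilon> powr \<eta>"
proof -
  interpret prob_space prob_\<omega> by (rule prob_space_prob_\<omega>)
  obtain C where C: "\<And>x k \<epsilon>. 0 < \<epsilon> \<Longrightarrow>
      outer_measure_of prob_\<omega> {\<omega> \<in> space prob_\<omega>. x \<in> (\<Union>\<alpha>\<in>idx k. boundary_layer \<epsilon> \<omega> k \<alpha>)}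
        \<le> ennreal (C * \<epsilon> powr \<eta>)"
    using assms unfolding boundary_exponent_def by blast
  show ?thesis
  proof
    fix x k \<epsilon> E
    assume \<epsilon>: "0 < (\<epsilon>::real)" and E: "E \<in> sets prob_\<omega>"
      and layer: "\<And>\<omega>. \<omega> \<in> E \<Longrightarrow> \<exists>\<alpha>\<in>idx k. x \<in> boundary_layer \<epsilon> \<omega> k \<alpha>"
    have "emeasure prob_\<omega> E = outer_measure_of prob_\<omega> E" using E by simp
    also have "\<dots> \<le> outer_measure_of prob_\<omega>
        {\<omega> \<in> space prob_\<omega>. x \<in> (\<Union>\<alpha>\<in>idx k. boundary_layer \<epsilon> \<omega> k \<alpha>)}"
      using layer sets.sets_into_space[OF E] by (intro outer_measure_of_mono) auto
    also have "\<dots> \<le> ennreal (C * \<epsilon> powr \<eta>)" using C[OF \<epsilon>] .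
    \<comment> \<open>Enlarging the constant makes it positive, so that it can be divided by
      later.\<close>
    also have "\<dots> \<le> ennreal ((\<bar>C\<bar> + 1) * \<epsilon> powr \<eta>)"
      by (intro ennreal_leI mult_right_mono) auto
    finally show "measure prob_\<omega> E \<le> (\<bar>C\<bar> + 1) * \<epsilon> powr \<eta>"
      by (simp add: emeasure_eq_measure)
  qed simp
qed

text \<open>An open set around x inside the closed cube of \<open>\<alpha>\<close> meets the
  pre-cube of \<open>\<beta>\<close>, and \<open>pre_cube_closed_cube_disjoint\<close> applies to a
  common point.\<close>

lemma open_cube_closed_cube_disjoint:
  assumes "x \<in> open_cube \<omega> k \<alpha>" "x \<in> closed_cube \<omega> k \<beta>"
  shows "\<alpha> = \<beta>"
proof -
  obtain T where T: "openin qtop T" "x \<in> T" "T \<subseteq> closed_cube \<omega> k \<alpha>"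
    using assms(1) by (auto simp: open_cube_def interior_of_def)
  then obtain y where "y \<in> pre_cube \<omega> k \<beta>" "y \<in> T"
    using assms(2) unfolding closed_cube_def in_closure_of by blast
  then show ?thesis using T(3) pre_cube_closed_cube_disjoint by blast
qed

lemma boundary_layerI:
  assumes "x \<in> closed_cube \<omega> k \<alpha>" "y \<notin> open_cube \<omega> k \<alpha>" "d x y < \<epsilon> * \<delta> powi k"
  shows "x \<in> boundary_layer \<epsilon> \<omega> k \<alpha>"
proof -
  have "dist_to_set x (UNIV - open_cube \<omega> k \<alpha>) \<le> ennreal (d x y)"
    unfolding dist_to_set_def using assms(2) by (intro INF_lower) auto
  also have "\<dots> < ennreal (\<epsilon> * \<delta> powi k)"
    using assms(3) d_nonneg by (intro ennreal_lessI) (auto intro: le_less_trans)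
  finally show ?thesis using assms(1) by (simp add: boundary_layer_def)
qed

lemma AE_closed_cube_unique:
  assumes "boundary_exponent \<eta>" "\<alpha> \<in> idx k" "\<alpha> \<noteq> \<beta>"
  shows "AE \<omega> in prob_\<omega>. x \<notin> closed_cube \<omega> k \<alpha> \<or> x \<notin> closed_cube \<omega> k \<beta>"
proof -
  interpret prob_space prob_\<omega> by (rule prob_space_prob_\<omega>)
  define E where "E = {\<omega> \<in> space prob_\<omega>. x \<in> closed_cube \<omega> k \<alpha> \<and> x \<in> closed_cube \<omega> k \<beta>}"
  have E: "E \<in> sets prob_\<omega>"
    unfolding E_def by (intro sets.sets_Collect_conj events_closed_cube)
  obtain C where C: "0 < C" "\<And>x k \<epsilon> E. 0 < \<epsilon> \<Longrightarrow> E \<in> sets prob_\<omega> \<Longrightarrow>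
      (\<And>\<omega>. \<omega> \<in> E \<Longrightarrow> \<exists>\<alpha>\<in>idx k. x \<in> boundary_layer \<epsilon> \<omega> k \<alpha>) \<Longrightarrow> prob E \<le> C * \<epsilon> powr \<eta>"
    using boundary_exponent_bound[OF assms(1)] by blast
  have \<eta>: "0 < \<eta>" using assms(1) by (simp add: boundary_exponent_def)
  have bound: "prob E \<le> C * \<epsilon> powr \<eta>" if "0 < \<epsilon>" for \<epsilon>
  proof (rule C(2)[OF that E])
    fix \<omega> assume "\<omega> \<in> E"
    then have "x \<in> closed_cube \<omega> k \<alpha>" "x \<notin> open_cube \<omega> k \<alpha>"
      using open_cube_closed_cube_disjoint assms(3) by (auto simp: E_def)
    \<comment> \<open>The witness outside the open cube is x itself, at distance 0, so every
      positive \<epsilon> is allowed.\<close>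
    then have "x \<in> boundary_layer \<epsilon> \<omega> k \<alpha>"
      using that by (intro boundary_layerI) auto
    then show "\<exists>\<alpha>\<in>idx k. x \<in> boundary_layer \<epsilon> \<omega> k \<alpha>" using assms(2) by blast
  qed
  have "prob E = 0"
  proof (rule ccontr)
    assume "prob E \<noteq> 0"
    then have pos: "0 < prob E" by (simp add: zero_less_measure_iff)
    \<comment> \<open>Chosen so that C \<epsilon>^\<eta> is half of \<open>prob E\<close>.\<close>
    define \<epsilon> where "\<epsilon> = (prob E / (2 * C)) powr (1 / \<eta>)"
    have "0 < \<epsilon>" using pos C(1) by (simp add: \<epsilon>_def)
    from bound[OF this] have "prob E \<le> C * (prob E / (2 * C))"
      using pos C(1) \<eta> by (simp add: \<epsilon>_def powr_powr)
    then show False using pos C(1) by simp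
  qed
  then have "E \<in> null_sets prob_\<omega>" using E by (simp add: emeasure_eq_measure null_setsI)
  then show ?thesis by (rule AE_I') (auto simp: E_def)
qed

section \<open>Support, partition of unity and interpolation\<close>

lemma spline_nonneg: "0 \<le> spline k \<alpha> x"
  by (simp add: spline_def)

lemma spline_le_1: "spline k \<alpha> x \<le> 1"
  unfolding spline_def by (rule prob_space.prob_le_1[OF prob_space_prob_\<omega>])

lemma spline_eq_0:
  assumes "\<alpha> \<in> idx k" "8 * A0 ^ 5 * \<delta> powi k \<le> d (pt k \<alpha>) x"
  shows "spline k \<alpha> x = 0"
proof -
  have "x \<notin> closed_cube \<omega> k \<alpha>" for \<omega>
    using closed_cube_bounded[OF assms(1), of x \<omega>] assms(2) by force
  then show ?thesis by (simp add: spline_def)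
qed

lemma spline_eq_1:
  assumes "\<alpha> \<in> idx k" "d (pt k \<alpha>) x < \<delta> powi k / (8 * A0 ^ 3)"
  shows "spline k \<alpha> x = 1"
  using ball_subset_closed_cube[OF assms] prob_space.prob_space[OF prob_space_prob_\<omega>]
  by (simp add: spline_def)

text \<open>Additivity holds because overlaps of closed cubes are null. The events may be smaller
  than cube membership, as in the refinement equation, where the new parent is prescribed
  too.\<close>

lemma prob_UN_closed_cube:
  assumes "boundary_exponent \<eta>" "finite I" "I \<subseteq> idx k"
    and "\<And>\<alpha>. \<alpha> \<in> I \<Longrightarrow> E \<alpha> \<in> sets prob_\<omega>"
    and "\<And>\<alpha> \<omega>. \<alpha> \<in> I \<Longrightarrow> \<omega> \<in> E \<alpha> \<Longrightarrow> x \<in> closed_cube \<omega> k \<alpha>"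
  shows "measure prob_\<omega> (\<Union>\<alpha>\<in>I. E \<alpha>) = (\<Sum>\<alpha>\<in>I. measure prob_\<omega> (E \<alpha>))"
proof -
  interpret prob_space prob_\<omega> by (rule prob_space_prob_\<omega>)
  show ?thesis
  proof (rule measure_UNION_AE)
    show "pairwise (\<lambda>\<alpha> \<beta>. AE \<omega> in prob_\<omega>. \<omega> \<notin> E \<alpha> \<or> \<omega> \<notin> E \<beta>) I"
    proof (rule pairwiseI)
      fix \<alpha> \<beta> assume "\<alpha> \<in> I" "\<beta> \<in> I" "\<alpha> \<noteq> \<beta>"
      then have "AE \<omega> in prob_\<omega>. x \<notin> closed_cube \<omega> k \<alpha> \<or> x \<notin> closed_cube \<omega> k \<beta>"
        using assms(3) by (intro AE_closed_cube_unique[OF assms(1)]) auto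
      then show "AE \<omega> in prob_\<omega>. \<omega> \<notin> E \<alpha> \<or> \<omega> \<notin> E \<beta>"
        by (rule eventually_mono) (use assms(5) \<open>\<alpha> \<in> I\<close> \<open>\<beta> \<in> I\<close> in blast)
    qed
  qed (use assms in \<open>auto simp: fmeasurable_eq_sets\<close>)
qed

lemma spline_has_sum:
  assumes "boundary_exponent \<eta>"
  shows "((\<lambda>\<alpha>. spline k \<alpha> x) has_sum 1) (idx k)"
proof -
  interpret prob_space prob_\<omega> by (rule prob_space_prob_\<omega>)
  define I where "I = {\<alpha> \<in> idx k. d x (pt k \<alpha>) < 8 * A0 ^ 5 * \<delta> powi k}"
  have I: "finite I" unfolding I_def by (rule finite_idx_near)
  have "\<exists>\<alpha>\<in>I. x \<in> closed_cube \<omega> k \<alpha>" for \<omega>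
    \<comment> \<open>The covering index lies in \<open>I\<close> for every \<omega>, since cubes
      have uniformly bounded extent.\<close>
    using closed_cube_cover[of k x \<omega>] closed_cube_bounded by (auto simp: I_def d_sym)
  then have "(\<Union>\<alpha>\<in>I. {\<omega> \<in> space prob_\<omega>. x \<in> closed_cube \<omega> k \<alpha>}) = space prob_\<omega>" by auto
  then have "(\<Sum>\<alpha>\<in>I. spline k \<alpha> x) = 1"
    unfolding spline_def using prob_space I events_closed_cube
    by (subst prob_UN_closed_cube[OF assms, of I k _ x, symmetric]) (auto simp: I_def)
  moreover have "((\<lambda>\<alpha>. spline k \<alpha> x) has_sum (\<Sum>\<alpha>\<in>I. spline k \<alpha> x)) (idx k)"
    using I spline_eq_0 by (intro has_sum_finite_neutralI) (auto simp: I_def d_sym not_less)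
  ultimately show ?thesis by simp
qed

text \<open>The inner ball gives the value 1 at the own reference point; the partition of unity then
  leaves nothing for the other nonnegative splines.\<close>

lemma spline_pt:
  assumes "boundary_exponent \<eta>" "\<alpha> \<in> idx k" "\<beta> \<in> idx k"
  shows "spline k \<alpha> (pt k \<beta>) = (if \<alpha> = \<beta> then 1 else 0)"
proof -
  have one: "spline k \<beta> (pt k \<beta>) = 1" using assms(3) A0_pos by (intro spline_eq_1) auto
  have "spline k \<alpha> (pt k \<beta>) = 0" if "\<alpha> \<noteq> \<beta>"
  proof -
    have "((\<lambda>\<gamma>. spline k \<gamma> (pt k \<beta>)) has_sum (\<Sum>\<gamma>\<in>{\<alpha>, \<beta>}. spline k \<gamma> (pt k \<beta>))) {\<alpha>, \<beta>}"
      by (rule has_sum_finite) simp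
    from has_sum_mono2[OF this spline_has_sum[OF assms(1)]]
    have "(\<Sum>\<gamma>\<in>{\<alpha>, \<beta>}. spline k \<gamma> (pt k \<beta>)) \<le> 1"
      using assms(2,3) spline_nonneg by auto
    then show ?thesis using that one spline_nonneg[of k \<alpha> "pt k \<beta>"] by simp
  qed
  then show ?thesis using one by simp
qed

section \<open>Refinement equation\<close>

definition refinement_coeff :: "int \<Rightarrow> 'i \<Rightarrow> 'i \<Rightarrow> real" where
  "refinement_coeff k \<alpha> \<beta> = measure prob_\<omega> {\<omega> \<in> space prob_\<omega>. new_par \<omega> k \<beta> = \<alpha>}"

lemma refinement_coeff_nonneg: "0 \<le> refinement_coeff k \<alpha> \<beta>"
  by (simp add: refinement_coeff_def)

lemma refinement_coeff_far:
  assumes "\<beta> \<in> idx (k + 1)" "9 / 4 * A0\<^sup>2 * \<delta> powi k \<le> d (pt (k + 1) \<beta>) (pt k \<alpha>)"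
  shows "refinement_coeff k \<alpha> \<beta> = 0"
proof -
  have "new_par \<omega> k \<beta> \<noteq> \<alpha>" for \<omega> using new_par_dist[OF assms(1), of \<omega>] assms(2) by auto
  then show ?thesis by (simp add: refinement_coeff_def)
qed

lemma refinement_coeff_has_sum:
  assumes "\<beta> \<in> idx (k + 1)"
  shows "((\<lambda>\<alpha>. refinement_coeff k \<alpha> \<beta>) has_sum 1) (idx k)"
proof -
  interpret prob_space prob_\<omega> by (rule prob_space_prob_\<omega>)
  define I where "I = {\<alpha> \<in> idx k. d (pt (k + 1) \<beta>) (pt k \<alpha>) < 9 / 4 * A0\<^sup>2 * \<delta> powi k}"
  have I: "finite I" unfolding I_def by (rule finite_idx_near)
  have "new_par \<omega> k \<beta> \<in> I" for \<omega>
    using new_par_idx[OF assms] new_par_dist[OF assms] by (simp add: I_def)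
  then have "(\<Union>\<alpha>\<in>I. {\<omega> \<in> space prob_\<omega>. new_par \<omega> k \<beta> = \<alpha>}) = space prob_\<omega>" by auto
  then have "(\<Sum>\<alpha>\<in>I. refinement_coeff k \<alpha> \<beta>) = 1"
    unfolding refinement_coeff_def using prob_space I events_new_par
    by (subst finite_measure_finite_Union[symmetric]) (auto simp: disjoint_family_on_def)
  moreover have "((\<lambda>\<alpha>. refinement_coeff k \<alpha> \<beta>) has_sum (\<Sum>\<alpha>\<in>I. refinement_coeff k \<alpha> \<beta>)) (idx k)"
    using I refinement_coeff_far[OF assms]
    by (intro has_sum_finite_neutralI) (auto simp: I_def not_less)
  ultimately show ?thesis by simp
qed

lemma finite_refinement_coeff: "finite {\<beta> \<in> idx (k + 1). refinement_coeff k \<alpha> \<beta> \<noteq> 0}"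
  by (rule finite_subset[OF _ finite_idx_near[of "k + 1" "pt k \<alpha>" "9 / 4 * A0\<^sup>2 * \<delta> powi k"]])
     (use refinement_coeff_far in \<open>force simp: d_sym\<close>)

lemma spline_refinement:
  assumes "boundary_exponent \<eta>" "\<alpha> \<in> idx k"
  shows "((\<lambda>\<beta>. refinement_coeff k \<alpha> \<beta> * spline (k + 1) \<beta> x) has_sum spline k \<alpha> x) (idx (k + 1))"
proof -
  interpret prob_space prob_\<omega> by (rule prob_space_prob_\<omega>)
  \<comment> \<open>A finite set independent of \<omega> that contains every possible new child of
    \<open>\<alpha>\<close>.\<close>
  define I where "I = {\<beta> \<in> idx (k + 1). d (pt k \<alpha>) (pt (k + 1) \<beta>) < 9 / 4 * A0\<^sup>2 * \<delta> powi k}"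
  have I: "finite I" unfolding I_def by (rule finite_idx_near)
  define E where "E \<beta> = {\<omega> \<in> space prob_\<omega>. new_par \<omega> k \<beta> = \<alpha> \<and> x \<in> closed_cube \<omega> (k + 1) \<beta>}" for \<beta>
  have E: "E \<beta> \<in> sets prob_\<omega>" for \<beta>
    unfolding E_def by (intro sets.sets_Collect_conj events_closed_cube events_new_par)
  have "x \<in> closed_cube \<omega> k \<alpha> \<longleftrightarrow> (\<exists>\<beta>\<in>I. new_par \<omega> k \<beta> = \<alpha> \<and> x \<in> closed_cube \<omega> (k + 1) \<beta>)" for \<omega>
    unfolding closed_cube_Suc[OF assms(2)] using new_par_dist[of _ k \<omega>] by (auto simp: I_def d_sym)
  then have "spline k \<alpha> x = prob (\<Union>\<beta>\<in>I. E \<beta>)"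
    unfolding spline_def by (intro arg_cong[of _ _ prob]) (auto simp: E_def)
  also have "\<dots> = (\<Sum>\<beta>\<in>I. prob (E \<beta>))"
    using I E by (intro prob_UN_closed_cube[OF assms(1), of I "k + 1" _ x]) (auto simp: I_def E_def)
  also have "\<dots> = (\<Sum>\<beta>\<in>I. refinement_coeff k \<alpha> \<beta> * spline (k + 1) \<beta> x)"
    by (simp add: E_def prob_new_par_closed_cube refinement_coeff_def)
  finally have sum: "(\<Sum>\<beta>\<in>I. refinement_coeff k \<alpha> \<beta> * spline (k + 1) \<beta> x) = spline k \<alpha> x" ..
  have "((\<lambda>\<beta>. refinement_coeff k \<alpha> \<beta> * spline (k + 1) \<beta> x) has_sum
      (\<Sum>\<beta>\<in>I. refinement_coeff k \<alpha> \<beta> * spline (k + 1) \<beta> x)) (idx (k + 1))"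
    using I refinement_coeff_far[of _ k \<alpha>]
    by (intro has_sum_finite_neutralI) (auto simp: I_def d_sym not_less)
  then show ?thesis using sum by simp
qed

text \<open>The difference of two splines is at most the probability that x lies in the closed cube
  and y does not; then y witnesses that x is in a boundary layer. Exchanging x and y gives the
  absolute value.\<close>

lemma spline_Hoelder:
  assumes "boundary_exponent \<eta>"
  shows "\<exists>C. \<forall>k. \<forall>\<alpha>\<in>idx k. \<forall>x y. \<bar>spline k \<alpha> x - spline k \<alpha> y\<bar> \<le> C * (d x y / \<delta> powi k) powr \<eta>"
proof -
  interpret prob_space prob_\<omega> by (rule prob_space_prob_\<omega>)
  obtain C where C: "0 < C" "\<And>x k \<epsilon> E. 0 < \<epsilon> \<Longrightarrow> E \<in> sets prob_\<omega> \<Longrightarrow>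
      (\<And>\<omega>. \<omega> \<in> E \<Longrightarrow> \<exists>\<alpha>\<in>idx k. x \<in> boundary_layer \<epsilon> \<omega> k \<alpha>) \<Longrightarrow> prob E \<le> C * \<epsilon> powr \<eta>"
    using boundary_exponent_bound[OF assms] by blast
  have one_sided: "spline k \<alpha> x - spline k \<alpha> y \<le> C * 2 powr \<eta> * (d x y / \<delta> powi k) powr \<eta>"
    if \<alpha>: "\<alpha> \<in> idx k" for k \<alpha> x y
  proof (cases "x = y")
    case False
    \<comment> \<open>The factor 2 makes d(x, y) < \<epsilon> \<delta>^k strict; it costs 2^\<eta>
      in the constant. The case x = y is split off to have \<epsilon> > 0.\<close>
    define \<epsilon> where "\<epsilon> = 2 * (d x y / \<delta> powi k)"
    define Ex Ey where "Ex = {\<omega> \<in> space prob_\<omega>. x \<in> closed_cube \<omega> k \<alpha>}"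
      and "Ey = {\<omega> \<in> space prob_\<omega>. y \<in> closed_cube \<omega> k \<alpha>}"
    have sets: "Ex \<in> sets prob_\<omega>" "Ey \<in> sets prob_\<omega>"
      by (auto simp: Ex_def Ey_def events_closed_cube)
    have dxy: "0 < d x y" using False d_nonneg[of x y] d_zero_iff[of x y] by simp
    have "prob Ex \<le> prob (Ey \<union> (Ex - Ey))" using sets by (intro finite_measure_mono) auto
    also have "\<dots> \<le> prob Ey + prob (Ex - Ey)" using sets by (intro measure_Un_le) auto
    finally have "spline k \<alpha> x - spline k \<alpha> y \<le> prob (Ex - Ey)"
      by (simp add: spline_def Ex_def Ey_def)
    also have "\<dots> \<le> C * \<epsilon> powr \<eta>"
    proof (rule C(2))
      show "0 < \<epsilon>" using dxy by (simp add: \<epsilon>_def)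
      show "Ex - Ey \<in> sets prob_\<omega>" using sets by simp
      fix \<omega> assume \<omega>: "\<omega> \<in> Ex - Ey"
      have "open_cube \<omega> k \<alpha> \<subseteq> closed_cube \<omega> k \<alpha>"
        unfolding open_cube_def by (rule interior_of_subset)
      moreover have "d x y < \<epsilon> * \<delta> powi k" using dxy \<delta>_pos by (simp add: \<epsilon>_def)
      ultimately have "x \<in> boundary_layer \<epsilon> \<omega> k \<alpha>"
        using \<omega> by (intro boundary_layerI[of _ _ _ _ y]) (auto simp: Ex_def Ey_def)
      then show "\<exists>\<alpha>\<in>idx k. x \<in> boundary_layer \<epsilon> \<omega> k \<alpha>" using \<alpha> by blast
    qed
    also have "\<dots> = C * 2 powr \<eta> * (d x y / \<delta> powi k) powr \<eta>"
      unfolding \<epsilon>_def by (subst powr_mult) (use dxy in \<open>auto simp: d_nonneg\<close>)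
    finally show ?thesis .
  qed simp
  have "\<bar>spline k \<alpha> x - spline k \<alpha> y\<bar> \<le> C * 2 powr \<eta> * (d x y / \<delta> powi k) powr \<eta>"
    if "\<alpha> \<in> idx k" for k \<alpha> x y
    using one_sided[OF that, of x y] one_sided[OF that, of y x] d_sym[of x y] by (simp add: abs_le_iff)
  then show ?thesis by blast
qed

end

theorem theorem3p2:
  fixes d :: "'a \<Rightarrow> 'a \<Rightarrow> real" and A0 \<delta> \<eta> :: real
    and idx :: "int \<Rightarrow> 'i set" and pt :: "int \<Rightarrow> 'i \<Rightarrow> 'a" and par :: "int \<Rightarrow> 'i \<Rightarrow> 'i"
    and label1 label2 :: "int \<Rightarrow> 'i \<Rightarrow> nat"
    and s :: "int \<Rightarrow> 'i \<Rightarrow> 'a \<Rightarrow> real"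
  assumes "random_dyadic_system d A0 \<delta> idx pt par label1 label2"
    and "random_dyadic_system.boundary_exponent d A0 \<delta> idx pt par label1 label2 \<eta>"
    and "s = random_dyadic_system.spline d A0 \<delta> idx pt par label1 label2"
  shows
    "(\<forall>k. \<forall>\<alpha>\<in>idx k. \<forall>x.
        indicat_real (quasi_metric_space.qball d (pt k \<alpha>) (1 / 8 * A0 powi (-3) * \<delta> powi k)) x
          \<le> s k \<alpha> x \<and>
        s k \<alpha> x \<le> indicat_real (quasi_metric_space.qball d (pt k \<alpha>) (8 * A0 ^ 5 * \<delta> powi k)) x)
     \<and>
     (\<forall>k. \<forall>\<alpha>\<in>idx k. \<forall>\<beta>\<in>idx k. s k \<alpha> (pt k \<beta>) = (if \<alpha> = \<beta> then 1 else 0))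
     \<and>
     (\<forall>k x. ((\<lambda>\<alpha>. s k \<alpha> x) has_sum 1) (idx k))
     \<and>
     (\<exists>p :: int \<Rightarrow> 'i \<Rightarrow> 'i \<Rightarrow> real.
        (\<forall>k. \<forall>\<alpha>\<in>idx k. \<forall>x.
           ((\<lambda>\<beta>. p k \<alpha> \<beta> * s (k + 1) \<beta> x) has_sum s k \<alpha> x) (idx (k + 1))) \<and>
        (\<forall>k. \<forall>\<alpha>\<in>idx k. \<forall>\<beta>\<in>idx (k + 1). 0 \<le> p k \<alpha> \<beta>) \<and>
        (\<forall>k. \<forall>\<alpha>\<in>idx k. finite {\<beta> \<in> idx (k + 1). p k \<alpha> \<beta> \<noteq> 0}) \<and>
        (\<forall>k. \<forall>\<beta>\<in>idx (k + 1). ((\<lambda>\<alpha>. p k \<alpha> \<beta>) has_sum 1) (idx k)))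
     \<and>
     (\<exists>C::real. \<forall>k. \<forall>\<alpha>\<in>idx k. \<forall>x y.
        \<bar>s k \<alpha> x - s k \<alpha> y\<bar> \<le> C * (d x y / \<delta> powi k) powr \<eta>)"
proof -
  interpret random_dyadic_system d A0 \<delta> idx pt par label1 label2
    by (rule assms(1))
  have \<eta>: "boundary_exponent \<eta>" and s: "s = spline" by (rule assms)+
  have inner: "1 / 8 * A0 powi (-3) * \<delta> powi k = \<delta> powi k / (8 * A0 ^ 3)" for k
    by (simp add: power_int_def divide_simps)
  have support: "indicat_real (qball (pt k \<alpha>) (1 / 8 * A0 powi (-3) * \<delta> powi k)) x \<le> s k \<alpha> x \<and>
      s k \<alpha> x \<le> indicat_real (qball (pt k \<alpha>) (8 * A0 ^ 5 * \<delta> powi k)) x"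
    if "\<alpha> \<in> idx k" for k \<alpha> x
  proof
    show "indicat_real (qball (pt k \<alpha>) (1 / 8 * A0 powi (-3) * \<delta> powi k)) x \<le> s k \<alpha> x"
      unfolding inner s using spline_nonneg spline_eq_1[OF that] by (auto simp: indicator_def qball_def)
    show "s k \<alpha> x \<le> indicat_real (qball (pt k \<alpha>) (8 * A0 ^ 5 * \<delta> powi k)) x"
      unfolding s using spline_le_1 spline_eq_0[OF that] by (auto simp: indicator_def qball_def not_less)
  qed
  show ?thesis
    using support spline_pt[OF \<eta>] spline_has_sum[OF \<eta>] spline_refinement[OF \<eta>]
      refinement_coeff_nonneg finite_refinement_coeff refinement_coeff_has_sum spline_Hoelder[OF \<eta>]
    unfolding s
    by (intro conjI allI ballI exI[of _ refinement_coeff]) blast+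
qed

end
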